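(* Let $N\ge1$ and $M\ge 2$ be integers. (i) If a set of $R$ configurations of an $M$-mode linear optical interferometer followed by photon counting allows reconstruction of every $N$-photon, $M$-mode state, then $$R\ge R_{N,M}:=\binom{N+M}{N}-\binom{N+M-2}{M}.$$ (ii) More generally, for an interferometer with $M'>M\ge 2$ modes, where the $N$-photon $M$-mode state is supplemented by $M'-M$ ancillary modes in the vacuum state, any set of $R$ configurations allowing reconstruction of every $N$-photon, $M$-mode state satisfies $$R\ge R_{N,M,M'}:=\left\lceil \frac{(N+M-2)!\,(M'-2)!}{(N+M'-2)!\,(M-2)!}\,R_{N,M}\right\rceil.$$
   Context: Let $a_1,\dots,a_{M'}$ be bosonic annihilation operators of $M'\ge M$ optical modes. An $N$-photon, $M$-mode state is a density operator $\rho$ on the span of Fock states $|k_1,\dots,k_M\rangle$ with $\sum_j k_j=N$. When $M'>M$ the input to the interferometer is $\rho\otimes|0\rangle\langle0|$ with the last $M'-M$ modes in vacuum. A configuration of an $M'$-mode linear optical interferometer is a unitary $g=e^{iH}\in\mathrm U(M')$ acting on Fock space as $U(g)=\exp\!\big(i\sum_{k,l}H_{kl}a_k^\dagger a_l\big)$. Photon counting on all $M'$ output modes after configuration $g$ gives outcome $\nu'$ (an $M'$-mode Fock state with $N$ photons) with probability $p_{\nu',g}=\langle\nu'|U(g)^\dagger(\rho\otimes|0\rangle\langle 0|)U(g)|\nu'\rangle$. A set of configurations $g_1,\dots,g_R$ allows reconstruction if the probabilities $(p_{\nu',g_j})_{\nu',j}$ determine $\rho$ uniquely (the map $\rho\mapsto(p_{\nu',g_j})$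 is injective). $\lceil x\rceil$ denotes the smallest integer greater than or equal to $x$. *)

theory Defs
  imports Complex_Main
begin

definition fock :: "nat \<Rightarrow> nat \<Rightarrow> (nat \<Rightarrow> nat) set" where
  "fock N M = {nu. (\<forall>j\<ge>M. nu j = 0) \<and> (\<Sum>j<M. nu j) = N}"

definition mmult :: "'i set \<Rightarrow> ('i \<Rightarrow> 'i \<Rightarrow> complex) \<Rightarrow> ('i \<Rightarrow> 'i \<Rightarrow> complex) \<Rightarrow> ('i \<Rightarrow> 'i \<Rightarrow> complex)" where
  "mmult I A B = (\<lambda>i j. \<Sum>k\<in>I. A i k * B k j)"

definition mid :: "'i \<Rightarrow> 'i \<Rightarrow> complex" where
  "mid = (\<lambda>i j. if i = j then 1 else 0)"

fun mpow :: "'i set \<Rightarrow> ('i \<Rightarrow> 'i \<Rightarrow> complex) \<Rightarrow> nat \<Rightarrow> ('i \<Rightarrow> 'i \<Rightarrow> complex)" where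
  "mpow I A 0 = mid"
| "mpow I A (Suc k) = mmult I A (mpow I A k)"

definition mexp :: "'i set \<Rightarrow> ('i \<Rightarrow> 'i \<Rightarrow> complex) \<Rightarrow> ('i \<Rightarrow> 'i \<Rightarrow> complex)" where
  "mexp I A = (\<lambda>i j. \<Sum>k. mpow I A k i j / of_nat (fact k))"

(* matrix element <mu| a_k^dagger a_l |nu> in the Fock basis *)
definition hop :: "nat \<Rightarrow> nat \<Rightarrow> (nat \<Rightarrow> nat) \<Rightarrow> (nat \<Rightarrow> nat) \<Rightarrow> complex" where
  "hop k l mu nu =
     (let nu1 = nu(l := nu l - 1) in
      if 0 < nu l \<and> mu = nu1(k := nu1 k + 1)
      then complex_of_real (sqrt (real (nu l)) * sqrt (real (nu1 k + 1)))
      else 0)"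

definition gen :: "nat \<Rightarrow> (nat \<Rightarrow> nat \<Rightarrow> complex) \<Rightarrow> (nat \<Rightarrow> nat) \<Rightarrow> (nat \<Rightarrow> nat) \<Rightarrow> complex" where
  "gen M' H = (\<lambda>mu nu. \<Sum>k<M'. \<Sum>l<M'. H k l * hop k l mu nu)"

definition hermitian_mat :: "nat \<Rightarrow> (nat \<Rightarrow> nat \<Rightarrow> complex) \<Rightarrow> bool" where
  "hermitian_mat M' H \<longleftrightarrow> (\<forall>k<M'. \<forall>l<M'. H k l = cnj (H l k))"

(* U(g) for g = exp(iH), restricted to the N-photon subspace of M' modes *)
definition Uop :: "nat \<Rightarrow> nat \<Rightarrow> (nat \<Rightarrow> nat \<Rightarrow> complex) \<Rightarrow> (nat \<Rightarrow> nat) \<Rightarrow> (nat \<Rightarrow> nat) \<Rightarrow> complex" where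
  "Uop N M' H = mexp (fock N M') (\<lambda>mu nu. \<i> * gen M' H mu nu)"

definition density_op :: "nat \<Rightarrow> nat \<Rightarrow> ((nat \<Rightarrow> nat) \<Rightarrow> (nat \<Rightarrow> nat) \<Rightarrow> complex) \<Rightarrow> bool" where
  "density_op N M rho \<longleftrightarrow>
     (\<forall>mu\<in>fock N M. \<forall>nu\<in>fock N M. rho mu nu = cnj (rho nu mu)) \<and>
     (\<forall>x :: (nat \<Rightarrow> nat) \<Rightarrow> complex.
        0 \<le> Re (\<Sum>mu\<in>fock N M. \<Sum>nu\<in>fock N M. cnj (x mu) * rho mu nu * x nu)) \<and>
     (\<Sum>mu\<in>fock N M. rho mu mu) = 1"

(* rho tensor vacuum on the extra modes M..M'-1 (M-mode states are the M'-mode states with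
   zero occupation in the ancillary modes) *)
definition ext_vac :: "nat \<Rightarrow> nat \<Rightarrow> ((nat \<Rightarrow> nat) \<Rightarrow> (nat \<Rightarrow> nat) \<Rightarrow> complex) \<Rightarrow> (nat \<Rightarrow> nat) \<Rightarrow> (nat \<Rightarrow> nat) \<Rightarrow> complex" where
  "ext_vac N M rho = (\<lambda>mu nu. if mu \<in> fock N M \<and> nu \<in> fock N M then rho mu nu else 0)"

definition prob :: "nat \<Rightarrow> nat \<Rightarrow> nat \<Rightarrow> ((nat \<Rightarrow> nat) \<Rightarrow> (nat \<Rightarrow> nat) \<Rightarrow> complex) \<Rightarrow> (nat \<Rightarrow> nat \<Rightarrow> complex) \<Rightarrow> (nat \<Rightarrow> nat) \<Rightarrow> complex" where
  "prob N M M' rho H nu' =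
     (let U = Uop N M' H in
      \<Sum>a\<in>fock N M'. \<Sum>b\<in>fock N M'. cnj (U a nu') * ext_vac N M rho a b * U b nu')"

definition reconstructs :: "nat \<Rightarrow> nat \<Rightarrow> nat \<Rightarrow> nat \<Rightarrow> (nat \<Rightarrow> nat \<Rightarrow> nat \<Rightarrow> complex) \<Rightarrow> bool" where
  "reconstructs N M M' R Hs \<longleftrightarrow>
     (\<forall>rho1 rho2. density_op N M rho1 \<longrightarrow> density_op N M rho2 \<longrightarrow>
        (\<forall>j<R. \<forall>nu'\<in>fock N M'. prob N M M' rho1 (Hs j) nu' = prob N M M' rho2 (Hs j) nu') \<longrightarrow>
        (\<forall>mu\<in>fock N M. \<forall>nu\<in>fock N M. rho1 mu nu = rho2 mu nu))"

definition R_NM :: "nat \<Rightarrow> nat \<Rightarrow> real" where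
  "R_NM N M = real ((N + M) choose N) - real ((N + M - 2) choose M)"

definition R_NMM' :: "nat \<Rightarrow> nat \<Rightarrow> nat \<Rightarrow> int" where
  "R_NMM' N M M' = ceiling (real (fact (N + M - 2) * fact (M' - 2))
                           / real (fact (N + M' - 2) * fact (M - 2)) * R_NM N M)"

end

theory Submission
  imports Defs
begin

text \<open>Operators \<open>T\<close> on the \<open>N\<close>-photon space with vanishing contraction \<open>\<Sum>k. a_k T a_k\<^sup>\<dagger>\<close>
  form a space of dimension at least \<open>D(N,M)\<^sup>2 - D(N-1,M)\<^sup>2\<close>, where \<open>D(N,M)\<close> is the dimension of the
  \<open>N\<close>-photon space of \<open>M\<close> modes. The contraction commutes with interferometers, so every
  \<open>U\<^sup>\<dagger> T U\<close> again has zero contraction; this determines its diagonal from the entries in which the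
  last mode is empty, of which there are \<open>D(N,M'-1)\<close>. Hence \<open>R\<close> configurations yield at most
  \<open>R * D(N,M'-1)\<close> independent equations on such \<open>T\<close>. If these leave a nonzero Hermitian \<open>T\<close>, then it is
  traceless and the states \<open>1/D\<close> and \<open>1/D + \<epsilon> T\<close> cannot be told apart. Since
  \<open>D(N,M) - D(N-1,M) = D(N,M-1)\<close>, the inequality
  \<open>D(N,M)\<^sup>2 - D(N-1,M)\<^sup>2 \<le> R * D(N,M'-1)\<close> is the claimed bound.\<close>

section \<open>Fock states\<close>

text \<open>The index shift behind the creation operator of mode \<open>k\<close>; the square-root
  amplitude is left to \<open>hop\<close> and \<open>wt\<close>.\<close>

definition inc :: "nat \<Rightarrow> (nat \<Rightarrow> nat) \<Rightarrow> nat \<Rightarrow> nat" where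
  "inc k \<nu> = \<nu>(k := \<nu> k + 1)"

text \<open>Truncated subtraction leaves a state with empty mode \<open>k\<close> unchanged, hence
  the positivity hypotheses in the rules below.\<close>

definition dec :: "nat \<Rightarrow> (nat \<Rightarrow> nat) \<Rightarrow> nat \<Rightarrow> nat" where
  "dec k \<nu> = \<nu>(k := \<nu> k - 1)"

lemma inc_commute: "inc k (inc l \<nu>) = inc l (inc k \<nu>)"
  by (auto simp: inc_def fun_eq_iff)

lemma inc_dec: "\<nu> k > 0 \<Longrightarrow> inc k (dec k \<nu>) = \<nu>"
  by (auto simp: inc_def dec_def fun_eq_iff)

lemma dec_inc: "dec k (inc k \<nu>) = \<nu>"
  by (auto simp: inc_def dec_def fun_eq_iff)

lemma dec_inc_commute: "\<nu> l > 0 \<Longrightarrow> dec l (inc k \<nu>) = inc k (dec l \<nu>)"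
  by (auto simp: inc_def dec_def fun_eq_iff)

lemma inj_inc: "inj (inc k)"
  by (metis dec_inc injI)

lemma sum_inc: "k < M \<Longrightarrow> (\<Sum>j<M. inc k \<nu> j) = Suc (\<Sum>j<M. \<nu> j)"
proof -
  assume k: "k < M"
  have "(\<Sum>j<M. inc k \<nu> j) = inc k \<nu> k + (\<Sum>j\<in>{..<M} - {k}. inc k \<nu> j)"
    using k by (intro sum.remove) auto
  also have "(\<Sum>j\<in>{..<M} - {k}. inc k \<nu> j) = (\<Sum>j\<in>{..<M} - {k}. \<nu> j)"
    by (intro sum.cong) (auto simp: inc_def)
  also have "inc k \<nu> k + \<dots> = Suc (\<nu> k + (\<Sum>j\<in>{..<M} - {k}. \<nu> j))"
    by (simp add: inc_def)
  also have "\<nu> k + (\<Sum>j\<in>{..<M} - {k}. \<nu> j) = (\<Sum>j<M. \<nu> j)"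
    using k by (intro sum.remove [symmetric]) auto
  finally show ?thesis .
qed

lemma inc_in_fock_iff: "k < M \<Longrightarrow> inc k \<nu> \<in> fock (Suc n) M \<longleftrightarrow> \<nu> \<in> fock n M"
proof -
  assume k: "k < M"
  then have "(\<forall>j\<ge>M. inc k \<nu> j = 0) \<longleftrightarrow> (\<forall>j\<ge>M. \<nu> j = 0)"
    by (auto simp: inc_def)
  then show ?thesis using k by (simp add: fock_def sum_inc)
qed

lemma inc_notin_fock: "k \<ge> M \<Longrightarrow> inc k \<nu> \<notin> fock n M"
  by (auto simp: fock_def inc_def)

lemma dec_in_fock: "\<nu> \<in> fock (Suc n) M \<Longrightarrow> \<nu> k > 0 \<Longrightarrow> dec k \<nu> \<in> fock n M"
  using inc_in_fock_iff[of k M "dec k \<nu>" n] inc_notin_fock[of M k "dec k \<nu>" "Suc n"] inc_dec[of \<nu> k]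
  by (cases "k < M") auto

text \<open>A hop conserves the photon number. An occupied mode \<open>l\<close> forces
  \<open>l < M\<close> and \<open>N > 0\<close>, so the hop passes through the space with one photon
  fewer.\<close>

lemma hop_target_in_fock:
  assumes "\<nu> \<in> fock N M" "\<nu> l > 0" "k < M"
  shows "inc k (dec l \<nu>) \<in> fock N M"
proof -
  have "l < M" using assms by (auto simp: fock_def intro: leI ccontr)
  then have "\<nu> l \<le> N" using assms by (auto simp: fock_def intro: member_le_sum)
  then obtain n where "N = Suc n" using assms(2) by (cases N) auto
  then show ?thesis using assms by (simp add: dec_in_fock inc_in_fock_iff)
qed

section \<open>Enumeration of Fock states\<close>

lemma fock_0: "fock 0 M = {\<lambda>_. 0}"
  by (auto simp: fock_def fun_eq_iff) (meson lessThan_iff not_le)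

lemma fock_Suc_0: "fock (Suc n) 0 = {}"
  by (auto simp: fock_def)

lemma fock_Suc_Suc: "fock (Suc n) (Suc M) = fock (Suc n) M \<union> inc M ` fock n (Suc M)"
proof (intro equalityI subsetI)
  fix \<nu> assume \<nu>: "\<nu> \<in> fock (Suc n) (Suc M)"
  show "\<nu> \<in> fock (Suc n) M \<union> inc M ` fock n (Suc M)"
  proof (cases "\<nu> M = 0")
    case True
    then show ?thesis using \<nu> by (auto simp: fock_def) (metis le_antisym not_less_eq_eq)
  next
    case False
    then show ?thesis using \<nu> dec_in_fock[of \<nu> n "Suc M" M] inc_dec[of \<nu> M] by force
  qed
next
  fix \<nu> assume "\<nu> \<in> fock (Suc n) M \<union> inc M ` fock n (Suc M)"
  then show "\<nu> \<in> fock (Suc n) (Suc M)"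
    using inc_in_fock_iff[of M "Suc M"] by (auto simp: fock_def)
qed

lemma finite_fock: "finite (fock n M)"
proof (induction M arbitrary: n)
  case 0
  then show ?case by (cases n) (auto simp: fock_0 fock_Suc_0)
next
  case (Suc M)
  show ?case by (induction n) (auto simp: fock_0 fock_Suc_Suc Suc.IH)
qed

lemma card_fock_Suc_Suc: "card (fock (Suc n) (Suc M)) = card (fock (Suc n) M) + card (fock n (Suc M))"
proof -
  have "fock (Suc n) M \<inter> inc M ` fock n (Suc M) = {}"
    using inc_notin_fock[of M M] by blast
  then show ?thesis
    unfolding fock_Suc_Suc
    by (subst card_Un_disjoint) (auto simp: finite_fock intro!: card_image inj_on_subset[OF inj_inc])
qed

text \<open>Stars and bars. Writing the number of modes as \<open>Suc M\<close> avoids a truncated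
  \<open>n + M - 1\<close>.\<close>

lemma card_fock: "card (fock n (Suc M)) = (n + M) choose n"
proof (induction M arbitrary: n)
  case 0
  show ?case by (induction n) (auto simp: fock_0 fock_Suc_0 card_fock_Suc_Suc)
next
  case (Suc M)
  show ?case
  proof (induction n)
    case (Suc n)
    \<comment> \<open>The fact quoted literally is the outer induction hypothesis, whose name is
      shadowed by the inner case.\<close>
    then show ?case using Suc.IH \<open>\<And>n. card (fock n (Suc M)) = (n + M) choose n\<close>
      by (simp add: card_fock_Suc_Suc[of n "Suc M"])
  qed (simp add: fock_0)
qed

section \<open>Contraction\<close>

text \<open>The norm of the unnormalised state made from the vacuum by creating \<nu> j photons in
  each mode j. Multiplying by these norms absorbs the amplitudes sqrt(\<nu> k + 1) of creation
  operators.\<close>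

definition wt :: "nat \<Rightarrow> (nat \<Rightarrow> nat) \<Rightarrow> complex" where
  "wt M \<nu> = of_real (sqrt (\<Prod>j<M. fact (\<nu> j)))"

lemma wt_inc: "k < M \<Longrightarrow> wt M (inc k \<nu>) = of_real (sqrt (real (\<nu> k + 1))) * wt M \<nu>"
proof -
  assume k: "k < M"
  have "(\<Prod>j<M. fact (inc k \<nu> j) :: real) = fact (inc k \<nu> k) * (\<Prod>j\<in>{..<M} - {k}. fact (inc k \<nu> j))"
    using k by (intro prod.remove) auto
  also have "(\<Prod>j\<in>{..<M} - {k}. fact (inc k \<nu> j) :: real) = (\<Prod>j\<in>{..<M} - {k}. fact (\<nu> j))"
    by (intro prod.cong) (auto simp: inc_def)
  also have "fact (inc k \<nu> k) * \<dots> = real (\<nu> k + 1) * (fact (\<nu> k) * (\<Prod>j\<in>{..<M} - {k}. fact (\<nu> j)))"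
    by (simp add: inc_def)
  also have "(fact (\<nu> k) * (\<Prod>j\<in>{..<M} - {k}. fact (\<nu> j) :: real)) = (\<Prod>j<M. fact (\<nu> j))"
    using k by (intro prod.remove [symmetric]) auto
  finally show ?thesis by (simp add: wt_def real_sqrt_mult)
qed

lemma wt_nonzero: "wt M \<nu> \<noteq> 0"
  by (simp add: wt_def)

lemma cnj_wt: "cnj (wt M \<nu>) = wt M \<nu>"
  by (simp add: wt_def)

text \<open>This is the matrix of \<open>\<Sum>k. a_k X a_k\<^sup>\<dagger>\<close>, with the entry at \<open>\<mu>, \<nu>\<close> multiplied by \<open>wt \<mu> * wt \<nu>\<close>.\<close>

definition contraction :: "nat \<Rightarrow> ((nat \<Rightarrow> nat) \<Rightarrow> (nat \<Rightarrow> nat) \<Rightarrow> complex) \<Rightarrow> (nat \<Rightarrow> nat) \<Rightarrow> (nat \<Rightarrow> nat) \<Rightarrow> complex" where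
  "contraction M X \<mu> \<nu> = (\<Sum>k<M. wt M (inc k \<mu>) * wt M (inc k \<nu>) * X (inc k \<mu>) (inc k \<nu>))"

section \<open>The generator in weighted coordinates\<close>

lemma hop_eq:
  "hop k l \<mu> \<nu> = (if 0 < \<nu> l \<and> \<mu> = inc k (dec l \<nu>)
     then of_real (sqrt (real (\<nu> l)) * sqrt (real (dec l \<nu> k + 1))) else 0)"
  by (simp add: hop_def inc_def dec_def Let_def)

text \<open>The adjoint of a_k^dagger a_l is a_l^dagger a_k, and the entries are real. A hop read
  backwards is the opposite hop, with its two square-root factors exchanged.\<close>

lemma hop_transpose: "hop k l \<mu> \<nu> = hop l k \<nu> \<mu>"
proof -
  have *: "0 < b k \<and> a = inc l (dec k b)" "dec l a k + 1 = b k" if "0 < a l" "b = inc k (dec l a)" for k l and a b :: "nat \<Rightarrow> nat"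
    using that by (auto simp: inc_def dec_def fun_eq_iff)
  show ?thesis
  proof (cases "0 < \<nu> l \<and> \<mu> = inc k (dec l \<nu>)")
    case True
    then have "dec l \<nu> k + 1 = \<mu> k" and T: "0 < \<mu> k \<and> \<nu> = inc l (dec k \<mu>)"
      using * by blast+
    moreover have "dec k \<mu> l + 1 = \<nu> l" using * T by blast
    ultimately show ?thesis
      unfolding hop_eq if_P[OF True] if_P[OF T] by (simp only: mult.commute)
  next
    case False
    then have "\<not> (0 < \<mu> k \<and> \<nu> = inc l (dec k \<mu>))" using *[of \<mu> k \<nu> l] by blast
    then show ?thesis using False by (simp only: hop_eq if_False)
  qed
qed

lemma cnj_hop: "cnj (hop k l \<mu> \<nu>) = hop k l \<mu> \<nu>"
  by (simp add: hop_eq)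

text \<open>Makes \<open>\<i> * gen M H\<close> anti-Hermitian, so that conjugation by its
  exponential differentiates to a commutator.\<close>

lemma cnj_gen:
  assumes "hermitian_mat M H"
  shows "cnj (gen M H \<mu> \<nu>) = gen M H \<nu> \<mu>"
proof -
  have "cnj (gen M H \<mu> \<nu>) = (\<Sum>k<M. \<Sum>l<M. cnj (H k l) * hop k l \<mu> \<nu>)"
    by (simp add: gen_def cnj_hop)
  also have "\<dots> = (\<Sum>k<M. \<Sum>l<M. H l k * hop l k \<nu> \<mu>)"
  proof (intro sum.cong refl)
    fix k l assume "k \<in> {..<M}" "l \<in> {..<M}"
    then have "H l k = cnj (H k l)" using assms unfolding hermitian_mat_def by blast
    then show "cnj (H k l) * hop k l \<mu> \<nu> = H l k * hop l k \<nu> \<mu>"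
      using hop_transpose[of k l \<mu> \<nu>] by simp
  qed
  also have "\<dots> = gen M H \<nu> \<mu>"
    unfolding gen_def by (rule sum.swap)
  finally show ?thesis .
qed

text \<open>The weights \<open>wt\<close> turn the Fock basis into the monomial basis, on which the generator acts
  as \<open>\<Sum> H k l * x_k * d/dx_l\<close> without square roots.\<close>

lemma gen_right:
  assumes "\<nu> \<in> fock N M"
  shows "wt M \<nu> * (\<Sum>\<kappa>\<in>fock N M. f \<kappa> * gen M H \<kappa> \<nu>)
       = (\<Sum>k<M. \<Sum>l<M. H k l * of_nat (\<nu> l) * (wt M (inc k (dec l \<nu>)) * f (inc k (dec l \<nu>))))"
proof -
  \<comment> \<open>For one hop the sum collapses to a single target. Both weights are multiples of
    the weight of \<open>dec l \<nu>\<close>; the two factors sqrt(\<nu> l) multiply to \<nu> l and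
    the other root is absorbed.\<close>
  have *: "wt M \<nu> * (\<Sum>\<kappa>\<in>fock N M. f \<kappa> * hop k l \<kappa> \<nu>)
      = of_nat (\<nu> l) * (wt M (inc k (dec l \<nu>)) * f (inc k (dec l \<nu>)))"
    if kl: "k < M" "l < M" for k l
  proof (cases "\<nu> l > 0")
    case True
    let ?\<xi> = "dec l \<nu>"
    have "(\<Sum>\<kappa>\<in>fock N M. f \<kappa> * hop k l \<kappa> \<nu>)
        = (\<Sum>\<kappa>\<in>fock N M. if \<kappa> = inc k ?\<xi> then f (inc k ?\<xi>) * of_real (sqrt (real (\<nu> l)) * sqrt (real (?\<xi> k + 1))) else 0)"
      using True by (intro sum.cong) (auto simp: hop_eq)
    also have "\<dots> = f (inc k ?\<xi>) * of_real (sqrt (real (\<nu> l)) * sqrt (real (?\<xi> k + 1)))"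
      using hop_target_in_fock[OF assms True \<open>k < M\<close>] by (simp add: finite_fock)
    finally have 1: "(\<Sum>\<kappa>\<in>fock N M. f \<kappa> * hop k l \<kappa> \<nu>) = \<dots>" .
    have 2: "wt M \<nu> = of_real (sqrt (real (\<nu> l))) * wt M ?\<xi>"
      using wt_inc[OF \<open>l < M\<close>, of ?\<xi>] inc_dec[of \<nu> l] True by (simp add: dec_def)
    have 3: "of_real (sqrt (real (\<nu> l))) * of_real (sqrt (real (\<nu> l))) = (of_nat (\<nu> l) :: complex)"
      by (metis of_nat_0_le_iff of_real_mult of_real_of_nat_eq real_sqrt_mult_self abs_of_nonneg)
    show ?thesis
      unfolding 1 2 wt_inc[OF \<open>k < M\<close>] 3[symmetric] by (simp add: algebra_simps)
  qed (simp add: hop_eq)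
  have "wt M \<nu> * (\<Sum>\<kappa>\<in>fock N M. f \<kappa> * gen M H \<kappa> \<nu>)
      = (\<Sum>\<kappa>\<in>fock N M. \<Sum>k<M. \<Sum>l<M. H k l * (wt M \<nu> * (f \<kappa> * hop k l \<kappa> \<nu>)))"
    by (simp add: gen_def sum_distrib_left mult_ac)
  also have "\<dots> = (\<Sum>k<M. \<Sum>\<kappa>\<in>fock N M. \<Sum>l<M. H k l * (wt M \<nu> * (f \<kappa> * hop k l \<kappa> \<nu>)))"
    by (rule sum.swap)
  also have "\<dots> = (\<Sum>k<M. \<Sum>l<M. \<Sum>\<kappa>\<in>fock N M. H k l * (wt M \<nu> * (f \<kappa> * hop k l \<kappa> \<nu>)))"
    by (intro sum.cong refl sum.swap)
  also have "\<dots> = (\<Sum>k<M. \<Sum>l<M. H k l * (wt M \<nu> * (\<Sum>\<kappa>\<in>fock N M. f \<kappa> * hop k l \<kappa> \<nu>)))"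
    by (simp add: sum_distrib_left)
  also have "\<dots> = (\<Sum>k<M. \<Sum>l<M. H k l * of_nat (\<nu> l) * (wt M (inc k (dec l \<nu>)) * f (inc k (dec l \<nu>))))"
    by (intro sum.cong refl) (simp add: * mult_ac)
  finally show ?thesis .
qed

text \<open>Reduces the action on a left index to \<open>gen_right\<close> with transposed
  coefficients.\<close>

lemma gen_transpose: "gen M H \<mu> \<nu> = gen M (\<lambda>k l. H l k) \<nu> \<mu>"
  unfolding gen_def by (subst sum.swap) (simp add: hop_transpose[of _ _ \<mu> \<nu>])

text \<open>Raising mode \<open>m\<close> and then applying \<open>x_k * d/dx_l\<close>: the last term is the commutator
  of the two.\<close>

lemma gen_inc:
  "of_nat (inc m \<nu> l) * F (inc k (dec l (inc m \<nu>)))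
     = of_nat (\<nu> l) * F (inc m (inc k (dec l \<nu>))) + (if m = l then F (inc k \<nu>) else (0::complex))"
proof (cases "\<nu> l > 0")
  case True
  then show ?thesis
    by (cases "m = l")
      (simp_all add: dec_inc_commute inc_commute dec_inc inc_dec algebra_simps,
       simp_all add: inc_def dec_def algebra_simps)
next
  case False
  then show ?thesis
    by (cases "m = l") (simp_all add: dec_inc, simp_all add: inc_def)
qed

text \<open>Moving the generator past \<open>inc m\<close> gives terms that are again contractions,
  zero by hypothesis, plus correction terms. The corrections from the two halves of the commutator
  coincide.\<close>

lemma contraction_commutator:
  assumes \<mu>: "\<mu> \<in> fock n M" and \<nu>: "\<nu> \<in> fock n M"
    and 0: "\<And>\<mu> \<nu>. \<mu> \<in> fock n M \<Longrightarrow> \<nu> \<in> fock n M \<Longrightarrow> contraction M X \<mu> \<nu> = 0"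
  shows "contraction M (\<lambda>\<mu> \<nu>. (\<Sum>\<kappa>\<in>fock (Suc n) M. X \<mu> \<kappa> * gen M H \<kappa> \<nu>)
           - (\<Sum>\<kappa>\<in>fock (Suc n) M. gen M H \<mu> \<kappa> * X \<kappa> \<nu>)) \<mu> \<nu> = 0"
proof -
  let ?I = "fock (Suc n) M"
  \<comment> \<open>With the weights absorbed, a contraction is the plain sum of \<open>Y\<close>
    over simultaneous increments.\<close>
  define Y where "Y \<mu> \<nu> = wt M \<mu> * wt M \<nu> * X \<mu> \<nu>" for \<mu> \<nu>
  have Y0: "(\<Sum>m<M. Y (inc m a) (inc m b)) = 0" if "a \<in> fock n M" "b \<in> fock n M" for a b
    using 0[OF that] by (simp add: contraction_def Y_def)
  have right: "wt M (inc m \<mu>) * wt M (inc m \<nu>) * (\<Sum>\<kappa>\<in>?I. X (inc m \<mu>) \<kappa> * gen M H \<kappa> (inc m \<nu>))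
      = (\<Sum>k<M. \<Sum>l<M. H k l * (of_nat (\<nu> l) * Y (inc m \<mu>) (inc m (inc k (dec l \<nu>)))
           + (if m = l then Y (inc m \<mu>) (inc k \<nu>) else 0)))" if "m < M" for m
  proof -
    have "inc m \<nu> \<in> ?I" using \<nu> that by (simp add: inc_in_fock_iff)
    from gen_right[OF this, of "\<lambda>\<kappa>. wt M (inc m \<mu>) * X (inc m \<mu>) \<kappa>" H]
    have "wt M (inc m \<mu>) * wt M (inc m \<nu>) * (\<Sum>\<kappa>\<in>?I. X (inc m \<mu>) \<kappa> * gen M H \<kappa> (inc m \<nu>))
      = (\<Sum>k<M. \<Sum>l<M. H k l * (of_nat (inc m \<nu> l) * Y (inc m \<mu>) (inc k (dec l (inc m \<nu>)))))"
      by (simp add: Y_def sum_distrib_left mult_ac)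
    then show ?thesis by (simp only: gen_inc)
  qed
  have left: "wt M (inc m \<mu>) * wt M (inc m \<nu>) * (\<Sum>\<kappa>\<in>?I. gen M H (inc m \<mu>) \<kappa> * X \<kappa> (inc m \<nu>))
      = (\<Sum>k<M. \<Sum>l<M. H l k * (of_nat (\<mu> l) * Y (inc m (inc k (dec l \<mu>))) (inc m \<nu>)
           + (if m = l then Y (inc k \<mu>) (inc m \<nu>) else 0)))" if "m < M" for m
  proof -
    have "inc m \<mu> \<in> ?I" using \<mu> that by (simp add: inc_in_fock_iff)
    from gen_right[OF this, of "\<lambda>\<kappa>. wt M (inc m \<nu>) * X \<kappa> (inc m \<nu>)" "\<lambda>k l. H l k"]
    have "wt M (inc m \<mu>) * wt M (inc m \<nu>) * (\<Sum>\<kappa>\<in>?I. gen M H (inc m \<mu>) \<kappa> * X \<kappa> (inc m \<nu>))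
      = (\<Sum>k<M. \<Sum>l<M. H l k * (of_nat (inc m \<mu> l) * Y (inc k (dec l (inc m \<mu>))) (inc m \<nu>)))"
      by (simp add: Y_def sum_distrib_left mult_ac gen_transpose[of M H "inc m \<mu>"])
    then show ?thesis by (simp only: gen_inc[where F = "\<lambda>\<xi>. Y \<xi> (inc m \<nu>)"])
  qed
  have swap3: "(\<Sum>m<M. \<Sum>k<M. \<Sum>l<M. f m k l) = (\<Sum>k<M. \<Sum>l<M. \<Sum>m<M. f m k l)"
    for f :: "nat \<Rightarrow> nat \<Rightarrow> nat \<Rightarrow> complex"
  proof -
    have "(\<Sum>m<M. \<Sum>k<M. \<Sum>l<M. f m k l) = (\<Sum>k<M. \<Sum>m<M. \<Sum>l<M. f m k l)"
      by (rule sum.swap)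
    also have "\<dots> = (\<Sum>k<M. \<Sum>l<M. \<Sum>m<M. f m k l)"
      by (intro sum.cong refl sum.swap)
    finally show ?thesis .
  qed
  have R: "(\<Sum>m<M. wt M (inc m \<mu>) * wt M (inc m \<nu>) * (\<Sum>\<kappa>\<in>?I. X (inc m \<mu>) \<kappa> * gen M H \<kappa> (inc m \<nu>)))
      = (\<Sum>k<M. \<Sum>l<M. H k l * Y (inc l \<mu>) (inc k \<nu>))"
  proof -
    have "(\<Sum>m<M. wt M (inc m \<mu>) * wt M (inc m \<nu>) * (\<Sum>\<kappa>\<in>?I. X (inc m \<mu>) \<kappa> * gen M H \<kappa> (inc m \<nu>)))
      = (\<Sum>m<M. \<Sum>k<M. \<Sum>l<M. H k l * (of_nat (\<nu> l) * Y (inc m \<mu>) (inc m (inc k (dec l \<nu>)))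
           + (if m = l then Y (inc m \<mu>) (inc k \<nu>) else 0)))"
      by (intro sum.cong refl right) simp
    also have "\<dots> = (\<Sum>k<M. \<Sum>l<M. \<Sum>m<M. H k l * (of_nat (\<nu> l) * Y (inc m \<mu>) (inc m (inc k (dec l \<nu>)))
           + (if m = l then Y (inc m \<mu>) (inc k \<nu>) else 0)))"
      by (rule swap3)
    also have "\<dots> = (\<Sum>k<M. \<Sum>l<M. H k l * Y (inc l \<mu>) (inc k \<nu>))"
    proof (intro sum.cong refl)
      fix k l assume kl: "k \<in> {..<M}" "l \<in> {..<M}"
      \<comment> \<open>The sum is the contraction at \<mu> and the hop target of \<nu>. If mode
        \<open>l\<close> is empty, the target may leave the Fock space, but the factor \<nu> l is
        0.\<close>
      have z: "of_nat (\<nu> l) * (\<Sum>m<M. Y (inc m \<mu>) (inc m (inc k (dec l \<nu>)))) = 0"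
        using Y0[OF \<mu> hop_target_in_fock[OF \<nu>, of l k]] kl by (cases "\<nu> l = 0") auto
      have "(\<Sum>m<M. H k l * (of_nat (\<nu> l) * Y (inc m \<mu>) (inc m (inc k (dec l \<nu>)))
           + (if m = l then Y (inc m \<mu>) (inc k \<nu>) else 0)))
        = H k l * (of_nat (\<nu> l) * (\<Sum>m<M. Y (inc m \<mu>) (inc m (inc k (dec l \<nu>))))
           + (\<Sum>m<M. if m = l then Y (inc m \<mu>) (inc k \<nu>) else 0))"
        by (simp only: sum_distrib_left[symmetric] sum.distrib)
      then show "(\<Sum>m<M. H k l * (of_nat (\<nu> l) * Y (inc m \<mu>) (inc m (inc k (dec l \<nu>)))
           + (if m = l then Y (inc m \<mu>) (inc k \<nu>) else 0))) = H k l * Y (inc l \<mu>) (inc k \<nu>)"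
        using kl unfolding z by simp
    qed
    finally show ?thesis .
  qed
  have L: "(\<Sum>m<M. wt M (inc m \<mu>) * wt M (inc m \<nu>) * (\<Sum>\<kappa>\<in>?I. gen M H (inc m \<mu>) \<kappa> * X \<kappa> (inc m \<nu>)))
      = (\<Sum>k<M. \<Sum>l<M. H l k * Y (inc k \<mu>) (inc l \<nu>))"
  proof -
    have "(\<Sum>m<M. wt M (inc m \<mu>) * wt M (inc m \<nu>) * (\<Sum>\<kappa>\<in>?I. gen M H (inc m \<mu>) \<kappa> * X \<kappa> (inc m \<nu>)))
      = (\<Sum>m<M. \<Sum>k<M. \<Sum>l<M. H l k * (of_nat (\<mu> l) * Y (inc m (inc k (dec l \<mu>))) (inc m \<nu>)
           + (if m = l then Y (inc k \<mu>) (inc m \<nu>) else 0)))"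
      by (intro sum.cong refl left) simp
    also have "\<dots> = (\<Sum>k<M. \<Sum>l<M. \<Sum>m<M. H l k * (of_nat (\<mu> l) * Y (inc m (inc k (dec l \<mu>))) (inc m \<nu>)
           + (if m = l then Y (inc k \<mu>) (inc m \<nu>) else 0)))"
      by (rule swap3)
    also have "\<dots> = (\<Sum>k<M. \<Sum>l<M. H l k * Y (inc k \<mu>) (inc l \<nu>))"
    proof (intro sum.cong refl)
      fix k l assume kl: "k \<in> {..<M}" "l \<in> {..<M}"
      have z: "of_nat (\<mu> l) * (\<Sum>m<M. Y (inc m (inc k (dec l \<mu>))) (inc m \<nu>)) = 0"
        using Y0[OF hop_target_in_fock[OF \<mu>, of l k] \<nu>] kl by (cases "\<mu> l = 0") auto
      have "(\<Sum>m<M. H l k * (of_nat (\<mu> l) * Y (inc m (inc k (dec l \<mu>))) (inc m \<nu>)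
           + (if m = l then Y (inc k \<mu>) (inc m \<nu>) else 0)))
        = H l k * (of_nat (\<mu> l) * (\<Sum>m<M. Y (inc m (inc k (dec l \<mu>))) (inc m \<nu>))
           + (\<Sum>m<M. if m = l then Y (inc k \<mu>) (inc m \<nu>) else 0))"
        by (simp only: sum_distrib_left[symmetric] sum.distrib)
      then show "(\<Sum>m<M. H l k * (of_nat (\<mu> l) * Y (inc m (inc k (dec l \<mu>))) (inc m \<nu>)
           + (if m = l then Y (inc k \<mu>) (inc m \<nu>) else 0))) = H l k * Y (inc k \<mu>) (inc l \<nu>)"
        using kl unfolding z by simp
    qed
    finally show ?thesis .
  qed
  \<comment> \<open>The two corrections differ only in the names of \<open>k\<close> and
    \<open>l\<close>.\<close>
  have "(\<Sum>k<M. \<Sum>l<M. H k l * Y (inc l \<mu>) (inc k \<nu>)) = (\<Sum>k<M. \<Sum>l<M. H l k * Y (inc k \<mu>) (inc l \<nu>))"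
    by (rule sum.swap)
  with L R show ?thesis
    by (simp add: contraction_def right_diff_distrib sum_subtractf)
qed

section \<open>Diagonal and trace of operators with zero contraction\<close>

text \<open>Zero contraction expresses the diagonal entries with last mode occupied through those
  with last mode less occupied.\<close>

lemma diagonal_zero:
  assumes 0: "\<And>\<mu>. \<mu> \<in> fock n (Suc M) \<Longrightarrow> contraction (Suc M) X \<mu> \<mu> = 0"
    and init: "\<And>\<nu>. \<nu> \<in> fock (Suc n) M \<Longrightarrow> X \<nu> \<nu> = 0"
    and \<nu>: "\<nu> \<in> fock (Suc n) (Suc M)"
  shows "X \<nu> \<nu> = 0"
  using \<nu>
proof (induction "\<nu> M" arbitrary: \<nu>)
  case 0
  then have "\<nu> \<in> fock (Suc n) M"
    unfolding fock_Suc_Suc by (auto simp: inc_def)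
  then show ?case by (rule init)
next
  case (Suc p)
  \<comment> \<open>In the contraction at this state the summand \<open>k = M\<close> carries the
    entry at \<nu>; all others have only \<open>p\<close> photons in the last mode and vanish by
    induction.\<close>
  let ?\<mu> = "dec M \<nu>"
  have pos: "\<nu> M > 0" using Suc by simp
  have \<mu>: "?\<mu> \<in> fock n (Suc M)" using Suc.prems pos by (rule dec_in_fock)
  have "X (inc k ?\<mu>) (inc k ?\<mu>) = 0" if "k < M" for k
  proof (rule Suc.hyps(1))
    show "p = inc k ?\<mu> M" using that Suc.hyps(2) by (simp add: inc_def dec_def)
    show "inc k ?\<mu> \<in> fock (Suc n) (Suc M)" using \<mu> that by (simp add: inc_in_fock_iff)
  qed
  then have "contraction (Suc M) X ?\<mu> ?\<mu> = wt (Suc M) \<nu> * wt (Suc M) \<nu> * X \<nu> \<nu>"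
    using inc_dec[of \<nu> M, OF pos] by (simp add: contraction_def)
  then show ?case using 0[OF \<mu>] wt_nonzero[of "Suc M" \<nu>] by simp
qed

text \<open>Substitute \<nu> = \<open>inc k \<mu>\<close>. States outside the image have mode
  \<open>k\<close> empty and are killed by the factor \<nu> k.\<close>

lemma sum_fock_inc:
  assumes "k < M"
  shows "(\<Sum>\<mu>\<in>fock n M. of_nat (\<mu> k + 1) * g (inc k \<mu>)) = (\<Sum>\<nu>\<in>fock (Suc n) M. of_nat (\<nu> k) * (g \<nu> :: complex))"
proof -
  have "(\<Sum>\<mu>\<in>fock n M. of_nat (\<mu> k + 1) * g (inc k \<mu>)) = (\<Sum>\<nu>\<in>inc k ` fock n M. of_nat (\<nu> k) * g \<nu>)"
    by (subst sum.reindex) (auto intro: inj_on_subset[OF inj_inc] simp: inc_def)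
  also have "\<dots> = (\<Sum>\<nu>\<in>fock (Suc n) M. of_nat (\<nu> k) * g \<nu>)"
  proof (rule sum.mono_neutral_left)
    show "\<forall>i\<in>fock (Suc n) M - inc k ` fock n M. of_nat (i k) * g i = 0"
      using inc_dec dec_in_fock by (metis DiffE image_eqI mult_zero_left neq0_conv of_nat_0)
  qed (use assms in \<open>auto simp: finite_fock inc_in_fock_iff\<close>)
  finally show ?thesis .
qed

text \<open>By cyclicity the trace of the sum of a_k X a_k^dagger is the trace of X times the photon
  number operator, which is the scalar n + 1 here.\<close>

lemma trace_zero:
  assumes 0: "\<And>\<mu>. \<mu> \<in> fock n M \<Longrightarrow> contraction M X \<mu> \<mu> = 0"
  shows "(\<Sum>\<nu>\<in>fock (Suc n) M. X \<nu> \<nu>) = 0"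
proof -
  have *: "(\<Sum>k<M. of_nat (\<mu> k + 1) * X (inc k \<mu>) (inc k \<mu>)) = 0" if "\<mu> \<in> fock n M" for \<mu>
  proof -
    have "contraction M X \<mu> \<mu> = (\<Sum>k<M. (wt M \<mu> * wt M \<mu>) * (of_nat (\<mu> k + 1) * X (inc k \<mu>) (inc k \<mu>)))"
      unfolding contraction_def
    proof (intro sum.cong refl)
      fix k assume "k \<in> {..<M}"
      moreover have "complex_of_real (sqrt (real (\<mu> k + 1))) * of_real (sqrt (real (\<mu> k + 1))) = of_nat (\<mu> k + 1)"
        by (metis of_nat_0_le_iff of_real_mult of_real_of_nat_eq real_sqrt_mult_self abs_of_nonneg)
      ultimately show "wt M (inc k \<mu>) * wt M (inc k \<mu>) * X (inc k \<mu>) (inc k \<mu>)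
          = (wt M \<mu> * wt M \<mu>) * (of_nat (\<mu> k + 1) * X (inc k \<mu>) (inc k \<mu>))"
        by (simp add: wt_inc mult_ac)
    qed
    then show ?thesis using 0[OF that] wt_nonzero[of M \<mu>] by (simp flip: sum_distrib_left)
  qed
  have "0 = (\<Sum>\<mu>\<in>fock n M. \<Sum>k<M. of_nat (\<mu> k + 1) * X (inc k \<mu>) (inc k \<mu>))"
    using * by simp
  also have "\<dots> = (\<Sum>k<M. \<Sum>\<mu>\<in>fock n M. of_nat (\<mu> k + 1) * X (inc k \<mu>) (inc k \<mu>))"
    by (rule sum.swap)
  also have "\<dots> = (\<Sum>k<M. \<Sum>\<nu>\<in>fock (Suc n) M. of_nat (\<nu> k) * X \<nu> \<nu>)"
    by (intro sum.cong refl sum_fock_inc[where g = "\<lambda>\<nu>. X \<nu> \<nu>"]) simp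
  also have "\<dots> = (\<Sum>\<nu>\<in>fock (Suc n) M. \<Sum>k<M. of_nat (\<nu> k) * X \<nu> \<nu>)"
    by (rule sum.swap)
  also have "\<dots> = (\<Sum>\<nu>\<in>fock (Suc n) M. of_nat (Suc n) * X \<nu> \<nu>)"
  proof (intro sum.cong refl)
    fix \<nu> assume "\<nu> \<in> fock (Suc n) M"
    then have "(\<Sum>k<M. \<nu> k) = Suc n" by (simp add: fock_def)
    then show "(\<Sum>k<M. of_nat (\<nu> k) * X \<nu> \<nu>) = of_nat (Suc n) * X \<nu> \<nu>"
      by (metis of_nat_sum sum_distrib_right)
  qed
  also have "\<dots> = of_nat (Suc n) * (\<Sum>\<nu>\<in>fock (Suc n) M. X \<nu> \<nu>)"
    by (rule sum_distrib_left[symmetric])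
  finally show ?thesis by (simp del: of_nat_Suc)
qed

section \<open>Underdetermined linear systems\<close>

text \<open>Gaussian elimination: each induction step drops an equation that is trivial or uses it
  to eliminate one unknown.\<close>

lemma underdetermined_system:
  fixes A :: "'e \<Rightarrow> 'i \<Rightarrow> 'a::field"
  assumes "finite E" "finite I" "card E < card I"
  shows "\<exists>x. (\<exists>i\<in>I. x i \<noteq> 0) \<and> (\<forall>e\<in>E. (\<Sum>i\<in>I. A e i * x i) = 0)"
  using assms
proof (induction E arbitrary: I A rule: finite_induct)
  case empty
  then have "I \<noteq> {}" by auto
  then show ?case by (intro exI[of _ "\<lambda>_. 1"]) auto
next
  case (insert e E)
  show ?case
  proof (cases "\<exists>p\<in>I. A e p \<noteq> 0")
    case False
    have "card E < card I" using insert by simp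
    from insert.IH[OF insert.prems(1) this, of A] False show ?thesis by auto
  next
    case True
    then obtain p where p: "p \<in> I" "A e p \<noteq> 0" by blast
    define J where "J = I - {p}"
    have J: "finite J" "card E < card J" using insert p by (auto simp: J_def)
    \<comment> \<open>The coefficients left after equation \<open>e\<close> is used to eliminate the
      pivot unknown \<open>p\<close>.\<close>
    define B where "B f i = A f i - A f p * A e i / A e p" for f i
    obtain x where x: "\<exists>i\<in>J. x i \<noteq> 0" "\<And>f. f \<in> E \<Longrightarrow> (\<Sum>i\<in>J. B f i * x i) = 0"
      using insert.IH[OF J, of B] by blast
    \<comment> \<open>The value that equation \<open>e\<close> forces on the pivot unknown.\<close>
    define c where "c = - (\<Sum>i\<in>J. A e i * x i) / A e p"
    define y where "y = x(p := c)"
    have y: "(\<Sum>i\<in>I. A f i * y i) = A f p * c + (\<Sum>i\<in>J. A f i * x i)" for f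
    proof -
      have "(\<Sum>i\<in>I. A f i * y i) = A f p * y p + (\<Sum>i\<in>J. A f i * y i)"
        unfolding J_def using insert.prems(1) p(1) by (rule sum.remove)
      also have "(\<Sum>i\<in>J. A f i * y i) = (\<Sum>i\<in>J. A f i * x i)"
        by (intro sum.cong) (auto simp: y_def J_def)
      finally show ?thesis by (simp add: y_def)
    qed
    have "(\<Sum>i\<in>I. A f i * y i) = 0" if "f \<in> E" for f
    proof -
      have "0 = (\<Sum>i\<in>J. A f i * x i - A f p / A e p * (A e i * x i))"
        using x(2)[OF that] by (simp add: B_def left_diff_distrib mult.assoc)
      also have "\<dots> = (\<Sum>i\<in>J. A f i * x i) - A f p / A e p * (\<Sum>i\<in>J. A e i * x i)"
        by (simp only: sum_subtractf sum_distrib_left)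
      finally show ?thesis unfolding y by (simp add: c_def)
    qed
    moreover have "(\<Sum>i\<in>I. A e i * y i) = 0"
      unfolding y using p(2) by (simp add: c_def)
    moreover have "\<exists>i\<in>I. y i \<noteq> 0"
      using x(1) by (auto simp: y_def J_def)
    ultimately show ?thesis by (intro exI[of _ y]) auto
  qed
qed

section \<open>Conjugation by a matrix exponential\<close>

text \<open>\<open>mpow\<close> recurs by left multiplication, whereas differentiating a conjugation
  needs the new factor at the outer, right index.\<close>

lemma mpow_Suc_right:
  assumes "finite I" "i \<in> I" "j \<in> I"
  shows "mpow I A (Suc k) i j = (\<Sum>\<kappa>\<in>I. mpow I A k i \<kappa> * A \<kappa> j)"
  using assms(2)
proof (induction k arbitrary: i)
  case 0
  then show ?case using assms(1,3)
    by (simp add: mmult_def mid_def if_distrib[where f = "\<lambda>x. _ * x"] if_distrib[where f = "\<lambda>x. x * _"] cong: if_cong)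
next
  case (Suc k)
  have "mpow I A (Suc (Suc k)) i j = (\<Sum>\<kappa>\<in>I. A i \<kappa> * mpow I A (Suc k) \<kappa> j)"
    by (simp add: mmult_def)
  also have "\<dots> = (\<Sum>\<kappa>\<in>I. \<Sum>c\<in>I. A i \<kappa> * mpow I A k \<kappa> c * A c j)"
    by (intro sum.cong refl) (simp add: Suc.IH sum_distrib_left mult.assoc del: mpow.simps)
  also have "\<dots> = (\<Sum>c\<in>I. \<Sum>\<kappa>\<in>I. A i \<kappa> * mpow I A k \<kappa> c * A c j)"
    by (rule sum.swap)
  also have "\<dots> = (\<Sum>c\<in>I. mpow I A (Suc k) i c * A c j)"
    by (simp add: mmult_def sum_distrib_right)
  finally show ?case .
qed

text \<open>The sum of all entry moduli dominates every row sum. The bound yields the absolute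
  convergence that the Cauchy product requires.\<close>

lemma norm_mpow_le:
  assumes "finite I" "i \<in> I"
  shows "norm (mpow I A k i j) \<le> (\<Sum>a\<in>I. \<Sum>b\<in>I. norm (A a b)) ^ k"
  using assms(2)
proof (induction k arbitrary: i)
  case 0
  then show ?case by (simp add: mid_def)
next
  case (Suc k)
  let ?C = "\<Sum>a\<in>I. \<Sum>b\<in>I. norm (A a b)"
  have "norm (mpow I A (Suc k) i j) \<le> (\<Sum>\<kappa>\<in>I. norm (A i \<kappa>) * ?C ^ k)"
    unfolding mpow.simps mmult_def
    by (rule sum_norm_le) (simp add: norm_mult Suc.IH mult_left_mono)
  also have "\<dots> = (\<Sum>\<kappa>\<in>I. norm (A i \<kappa>)) * ?C ^ k"
    by (simp add: sum_distrib_right)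
  also have "\<dots> \<le> ?C * ?C ^ k"
    using Suc.prems assms(1)
    by (intro mult_right_mono zero_le_power sum_nonneg member_le_sum[of i I "\<lambda>a. \<Sum>b\<in>I. norm (A a b)"]) auto
  finally show ?case by simp
qed

lemma summable_norm_mexp:
  assumes "finite I" "i \<in> I"
  shows "summable (\<lambda>k. norm (mpow I A k i j / of_nat (fact k)))"
proof (rule summable_comparison_test)
  let ?C = "\<Sum>a\<in>I. \<Sum>b\<in>I. norm (A a b)"
  show "summable (\<lambda>k. inverse (fact k) * ?C ^ k)" by (rule summable_exp)
  show "\<exists>N. \<forall>k\<ge>N. norm (norm (mpow I A k i j / of_nat (fact k))) \<le> inverse (fact k) * ?C ^ k"
    using norm_mpow_le[OF assms, of A _ j]
    by (intro exI[of _ 0]) (simp add: norm_divide field_simps)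
qed

text \<open>The Leibniz rule for power series, read off at degree n: the factor n + 1 splits as i +
  (n + 1 - i).\<close>

lemma Cauchy_product_derivation:
  fixes f g :: "nat \<Rightarrow> complex"
  assumes f: "\<And>k. of_nat (Suc k) * f (Suc k) = f' k" and g: "\<And>k. of_nat (Suc k) * g (Suc k) = g' k"
  shows "of_nat (Suc n) * (\<Sum>i\<le>Suc n. f i * g (Suc n - i))
       = (\<Sum>i\<le>n. f i * g' (n - i)) + (\<Sum>i\<le>n. f' i * g (n - i))"
proof -
  have "of_nat (Suc n) * (\<Sum>i\<le>Suc n. f i * g (Suc n - i))
      = (\<Sum>i\<le>Suc n. of_nat i * f i * g (Suc n - i) + f i * (of_nat (Suc n - i) * g (Suc n - i)))"
    unfolding sum_distrib_left
  proof (intro sum.cong refl)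
    fix i assume "i \<in> {..Suc n}"
    then have "of_nat (Suc n) = (of_nat i + of_nat (Suc n - i) :: complex)"
      by (metis atMost_iff le_add_diff_inverse of_nat_add)
    then show "of_nat (Suc n) * (f i * g (Suc n - i)) = of_nat i * f i * g (Suc n - i) + f i * (of_nat (Suc n - i) * g (Suc n - i))"
      by (simp only:) (simp add: algebra_simps)
  qed
  also have "\<dots> = (\<Sum>i\<le>Suc n. of_nat i * f i * g (Suc n - i)) + (\<Sum>i\<le>Suc n. f i * (of_nat (Suc n - i) * g (Suc n - i)))"
    by (rule sum.distrib)
  also have "(\<Sum>i\<le>Suc n. of_nat i * f i * g (Suc n - i)) = (\<Sum>i\<le>n. f' i * g (n - i))"
    unfolding sum.atMost_Suc_shift using f by simp
  also have "(\<Sum>i\<le>Suc n. f i * (of_nat (Suc n - i) * g (Suc n - i))) = (\<Sum>i\<le>n. f i * g' (n - i))"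
  proof -
    have "(\<Sum>i\<le>Suc n. f i * (of_nat (Suc n - i) * g (Suc n - i))) = (\<Sum>i\<le>n. f i * (of_nat (Suc n - i) * g (Suc n - i)))"
      by simp
    also have "\<dots> = (\<Sum>i\<le>n. f i * g' (n - i))"
      by (intro sum.cong refl) (simp add: Suc_diff_le g del: of_nat_Suc)
    finally show ?thesis .
  qed
  finally show ?thesis by (simp add: add.commute)
qed

text \<open>The coefficient of t^n in U(t)^dagger X U(t), where U(t) = exp(t A).\<close>

definition conj_coeff ::
  "'i set \<Rightarrow> ('i \<Rightarrow> 'i \<Rightarrow> complex) \<Rightarrow> ('i \<Rightarrow> 'i \<Rightarrow> complex) \<Rightarrow> nat \<Rightarrow> 'i \<Rightarrow> 'i \<Rightarrow> complex" where
  "conj_coeff I A X n \<mu> \<nu> = (\<Sum>a\<in>I. \<Sum>b\<in>I. X a b *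
     (\<Sum>i\<le>n. cnj (mpow I A i a \<mu> / of_nat (fact i)) * (mpow I A (n - i) b \<nu> / of_nat (fact (n - i)))))"

text \<open>The power series evaluated at t = 1; each entry is a Cauchy product of two absolutely
  convergent series.\<close>

lemma conj_coeff_sums:
  assumes "finite I"
  shows "(\<lambda>n. conj_coeff I A X n \<mu> \<nu>) sums
           (\<Sum>a\<in>I. \<Sum>b\<in>I. cnj (mexp I A a \<mu>) * X a b * mexp I A b \<nu>)"
proof -
  have "(\<lambda>n. X a b * (\<Sum>i\<le>n. cnj (mpow I A i a \<mu> / of_nat (fact i)) * (mpow I A (n - i) b \<nu> / of_nat (fact (n - i)))))
     sums (cnj (mexp I A a \<mu>) * X a b * mexp I A b \<nu>)" if "a \<in> I" "b \<in> I" for a b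
  proof -
    have na: "summable (\<lambda>k. norm (mpow I A k a \<mu> / of_nat (fact k)))"
      and nb: "summable (\<lambda>k. norm (mpow I A k b \<nu> / of_nat (fact k)))"
      by (rule summable_norm_mexp; fact assms that)+
    have na': "summable (\<lambda>k. norm (cnj (mpow I A k a \<mu> / of_nat (fact k))))"
      using na unfolding complex_mod_cnj .
    have "(\<lambda>k. cnj (mpow I A k a \<mu> / of_nat (fact k))) sums cnj (mexp I A a \<mu>)"
      unfolding sums_cnj mexp_def using summable_norm_cancel[OF na] by (rule summable_sums)
    then have "(\<Sum>k. cnj (mpow I A k a \<mu> / of_nat (fact k))) = cnj (mexp I A a \<mu>)"
      by (rule sums_unique[symmetric])
    with Cauchy_product_sums[OF na' nb]
    have "(\<lambda>n. \<Sum>i\<le>n. cnj (mpow I A i a \<mu> / of_nat (fact i)) * (mpow I A (n - i) b \<nu> / of_nat (fact (n - i))))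
      sums (cnj (mexp I A a \<mu>) * mexp I A b \<nu>)"
      by (simp only: mexp_def)
    from sums_mult[OF this, of "X a b"] show ?thesis by (simp only: mult_ac)
  qed
  then show ?thesis
    unfolding conj_coeff_def by (intro sums_sum)
qed

lemma conj_coeff_0:
  assumes "finite I" "\<mu> \<in> I" "\<nu> \<in> I"
  shows "conj_coeff I A X 0 \<mu> \<nu> = X \<mu> \<nu>"
proof -
  have "conj_coeff I A X 0 \<mu> \<nu> = (\<Sum>a\<in>I. \<Sum>b\<in>I. if b = \<nu> then (if a = \<mu> then X \<mu> \<nu> else 0) else 0)"
    unfolding conj_coeff_def by (intro sum.cong refl) (auto simp: mid_def)
  then show ?thesis using assms by simp
qed

text \<open>The coefficient form of Y' = Y A + A^dagger Y for Y(t) = U(t)^dagger X U(t), which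
  follows from U' = U A and the Leibniz rule.\<close>

lemma conj_coeff_Suc:
  assumes I: "finite I" and \<mu>: "\<mu> \<in> I" and \<nu>: "\<nu> \<in> I"
  shows "of_nat (Suc n) * conj_coeff I A X (Suc n) \<mu> \<nu>
       = (\<Sum>\<kappa>\<in>I. conj_coeff I A X n \<mu> \<kappa> * A \<kappa> \<nu>) + (\<Sum>\<kappa>\<in>I. cnj (A \<kappa> \<mu>) * conj_coeff I A X n \<kappa> \<nu>)"
proof -
  define u where "u k a c = mpow I A k a c / of_nat (fact k)" for k a c
  have u: "of_nat (Suc k) * u (Suc k) a c = (\<Sum>\<kappa>\<in>I. u k a \<kappa> * A \<kappa> c)" if "a \<in> I" "c \<in> I" for k a c
  proof -
    have "of_nat (Suc k) * u (Suc k) a c = mpow I A (Suc k) a c / of_nat (fact k)"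
      unfolding u_def fact_Suc of_nat_mult by (simp del: mpow.simps of_nat_Suc)
    then show ?thesis
      unfolding mpow_Suc_right[OF I that] by (simp add: u_def sum_divide_distrib)
  qed
  have ucnj: "of_nat (Suc k) * cnj (u (Suc k) a c) = (\<Sum>\<kappa>\<in>I. cnj (u k a \<kappa>) * cnj (A \<kappa> c))"
    if "a \<in> I" "c \<in> I" for k a c
    using arg_cong[OF u[OF that, of k], of cnj] by (simp del: of_nat_Suc)
  \<comment> \<open>The Cauchy product belonging to one entry \<open>X a b\<close>; the recurrence
    is proved for it and then summed over all entries.\<close>
  define s where "s n a b c d = (\<Sum>i\<le>n. cnj (u i a c) * u (n - i) b d)" for n a b c d
  have s: "of_nat (Suc n) * s (Suc n) a b \<mu> \<nu> = (\<Sum>\<kappa>\<in>I. s n a b \<mu> \<kappa> * A \<kappa> \<nu>) + (\<Sum>\<kappa>\<in>I. cnj (A \<kappa> \<mu>) * s n a b \<kappa> \<nu>)"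
    if ab: "a \<in> I" "b \<in> I" for a b
  proof -
    have "of_nat (Suc n) * s (Suc n) a b \<mu> \<nu>
       = (\<Sum>i\<le>n. cnj (u i a \<mu>) * (\<Sum>\<kappa>\<in>I. u (n - i) b \<kappa> * A \<kappa> \<nu>))
       + (\<Sum>i\<le>n. (\<Sum>\<kappa>\<in>I. cnj (u i a \<kappa>) * cnj (A \<kappa> \<mu>)) * u (n - i) b \<nu>)"
      unfolding s_def
      by (rule Cauchy_product_derivation) (rule ucnj u; use ab \<mu> \<nu> in simp)+
    also have "(\<Sum>i\<le>n. cnj (u i a \<mu>) * (\<Sum>\<kappa>\<in>I. u (n - i) b \<kappa> * A \<kappa> \<nu>)) = (\<Sum>\<kappa>\<in>I. s n a b \<mu> \<kappa> * A \<kappa> \<nu>)"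
      unfolding s_def sum_distrib_left sum_distrib_right by (subst sum.swap) (simp add: mult_ac)
    also have "(\<Sum>i\<le>n. (\<Sum>\<kappa>\<in>I. cnj (u i a \<kappa>) * cnj (A \<kappa> \<mu>)) * u (n - i) b \<nu>) = (\<Sum>\<kappa>\<in>I. cnj (A \<kappa> \<mu>) * s n a b \<kappa> \<nu>)"
      unfolding s_def sum_distrib_left sum_distrib_right by (subst sum.swap) (simp add: mult_ac)
    finally show ?thesis .
  qed
  have y: "conj_coeff I A X n c d = (\<Sum>(a, b)\<in>I \<times> I. X a b * s n a b c d)" for n c d
    by (simp add: conj_coeff_def s_def u_def sum.cartesian_product)
  have "of_nat (Suc n) * conj_coeff I A X (Suc n) \<mu> \<nu>
      = (\<Sum>(a, b)\<in>I \<times> I. X a b * (of_nat (Suc n) * s (Suc n) a b \<mu> \<nu>))"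
    unfolding y sum_distrib_left by (intro sum.cong refl) (auto simp: mult_ac)
  also have "\<dots> = (\<Sum>(a, b)\<in>I \<times> I. (\<Sum>\<kappa>\<in>I. X a b * s n a b \<mu> \<kappa> * A \<kappa> \<nu>)
      + (\<Sum>\<kappa>\<in>I. cnj (A \<kappa> \<mu>) * (X a b * s n a b \<kappa> \<nu>)))"
  proof (intro sum.cong refl, clarify)
    fix a b assume ab: "a \<in> I" "b \<in> I"
    show "X a b * (of_nat (Suc n) * s (Suc n) a b \<mu> \<nu>) = (\<Sum>\<kappa>\<in>I. X a b * s n a b \<mu> \<kappa> * A \<kappa> \<nu>)
      + (\<Sum>\<kappa>\<in>I. cnj (A \<kappa> \<mu>) * (X a b * s n a b \<kappa> \<nu>))"
      unfolding s[OF ab] by (simp add: distrib_left sum_distrib_left mult_ac)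
  qed
  also have "\<dots> = (\<Sum>p\<in>I \<times> I. \<Sum>\<kappa>\<in>I. X (fst p) (snd p) * s n (fst p) (snd p) \<mu> \<kappa> * A \<kappa> \<nu>)
      + (\<Sum>p\<in>I \<times> I. \<Sum>\<kappa>\<in>I. cnj (A \<kappa> \<mu>) * (X (fst p) (snd p) * s n (fst p) (snd p) \<kappa> \<nu>))"
    by (simp add: case_prod_unfold sum.distrib)
  also have "(\<Sum>p\<in>I \<times> I. \<Sum>\<kappa>\<in>I. X (fst p) (snd p) * s n (fst p) (snd p) \<mu> \<kappa> * A \<kappa> \<nu>)
      = (\<Sum>\<kappa>\<in>I. conj_coeff I A X n \<mu> \<kappa> * A \<kappa> \<nu>)"
    unfolding y sum_distrib_right case_prod_unfold by (rule sum.swap)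
  also have "(\<Sum>p\<in>I \<times> I. \<Sum>\<kappa>\<in>I. cnj (A \<kappa> \<mu>) * (X (fst p) (snd p) * s n (fst p) (snd p) \<kappa> \<nu>))
      = (\<Sum>\<kappa>\<in>I. cnj (A \<kappa> \<mu>) * conj_coeff I A X n \<kappa> \<nu>)"
    unfolding y sum_distrib_left case_prod_unfold by (rule sum.swap)
  finally show ?thesis .
qed

text \<open>Matrices are total functions, while the recurrences for them hold only on Fock states;
  this lemma bridges the gap.\<close>

lemma contraction_cong:
  assumes "\<mu> \<in> fock n M" "\<nu> \<in> fock n M"
    and "\<And>a b. a \<in> fock (Suc n) M \<Longrightarrow> b \<in> fock (Suc n) M \<Longrightarrow> X a b = Y a b"
  shows "contraction M X \<mu> \<nu> = contraction M Y \<mu> \<nu>"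
  unfolding contraction_def using assms by (intro sum.cong refl) (auto simp: inc_in_fock_iff)

lemma contraction_scale: "contraction M (\<lambda>a b. c * X a b) \<mu> \<nu> = c * contraction M X \<mu> \<nu>"
  by (simp add: contraction_def sum_distrib_left mult_ac)

text \<open>Each Taylor coefficient of \<open>U(t)\<^sup>\<dagger> X U(t)\<close> is a multiple of an iterated commutator with the generator.\<close>

lemma contraction_conjugate:
  assumes H: "hermitian_mat M H"
    and 0: "\<And>\<mu> \<nu>. \<mu> \<in> fock n M \<Longrightarrow> \<nu> \<in> fock n M \<Longrightarrow> contraction M X \<mu> \<nu> = 0"
    and \<mu>: "\<mu> \<in> fock n M" and \<nu>: "\<nu> \<in> fock n M"
  shows "contraction M (\<lambda>\<mu> \<nu>. \<Sum>a\<in>fock (Suc n) M. \<Sum>b\<in>fock (Suc n) M.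
           cnj (Uop (Suc n) M H a \<mu>) * X a b * Uop (Suc n) M H b \<nu>) \<mu> \<nu> = 0"
proof -
  let ?I = "fock (Suc n) M"
  define A where "A = (\<lambda>\<mu> \<nu>. \<i> * gen M H \<mu> \<nu>)"
  let ?y = "conj_coeff ?I A X"
  \<comment> \<open>Since the adjoint of \<open>A\<close> is its negative, the two terms of the
    recurrence form a commutator.\<close>
  have step: "of_nat (Suc k) * ?y (Suc k) c d
      = \<i> * ((\<Sum>\<kappa>\<in>?I. ?y k c \<kappa> * gen M H \<kappa> d) - (\<Sum>\<kappa>\<in>?I. gen M H c \<kappa> * ?y k \<kappa> d))"
    if "c \<in> ?I" "d \<in> ?I" for k c d
    unfolding conj_coeff_Suc[OF finite_fock that]
    by (simp add: A_def cnj_gen[OF H] right_diff_distrib sum_distrib_left mult_ac sum_negf)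
  have y0: "contraction M (?y k) c d = 0" if "c \<in> fock n M" "d \<in> fock n M" for k c d
    using that
  proof (induction k arbitrary: c d)
    case 0
    then have "contraction M (?y 0) c d = contraction M X c d"
      by (rule contraction_cong) (simp_all add: conj_coeff_0 finite_fock)
    then show ?case using 0 assms(2) by simp
  next
    case (Suc k)
    have "of_nat (Suc k) * contraction M (?y (Suc k)) c d
        = contraction M (\<lambda>c d. of_nat (Suc k) * ?y (Suc k) c d) c d"
      by (rule contraction_scale[symmetric])
    also have "\<dots> = contraction M (\<lambda>c d. \<i> * ((\<Sum>\<kappa>\<in>?I. ?y k c \<kappa> * gen M H \<kappa> d) - (\<Sum>\<kappa>\<in>?I. gen M H c \<kappa> * ?y k \<kappa> d))) c d"
      using Suc.prems by (rule contraction_cong) (rule step)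
    also have "\<dots> = \<i> * contraction M (\<lambda>c d. (\<Sum>\<kappa>\<in>?I. ?y k c \<kappa> * gen M H \<kappa> d) - (\<Sum>\<kappa>\<in>?I. gen M H c \<kappa> * ?y k \<kappa> d)) c d"
      by (rule contraction_scale)
    also have "contraction M (\<lambda>c d. (\<Sum>\<kappa>\<in>?I. ?y k c \<kappa> * gen M H \<kappa> d) - (\<Sum>\<kappa>\<in>?I. gen M H c \<kappa> * ?y k \<kappa> d)) c d = 0"
      using Suc.prems by (rule contraction_commutator) (rule Suc.IH)
    finally show ?case by (simp del: of_nat_Suc)
  qed
  \<comment> \<open>A contraction is a finite sum, so it may be taken term by term in the
    series.\<close>
  have "(\<lambda>k. contraction M (?y k) \<mu> \<nu>) sums
    contraction M (\<lambda>\<mu> \<nu>. \<Sum>a\<in>?I. \<Sum>b\<in>?I. cnj (Uop (Suc n) M H a \<mu>) * X a b * Uop (Suc n) M H b \<nu>) \<mu> \<nu>"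
    unfolding contraction_def Uop_def A_def
    by (intro sums_sum sums_mult conj_coeff_sums finite_fock)
  then have "(\<lambda>k. 0) sums
    contraction M (\<lambda>\<mu> \<nu>. \<Sum>a\<in>?I. \<Sum>b\<in>?I. cnj (Uop (Suc n) M H a \<mu>) * X a b * Uop (Suc n) M H b \<nu>) \<mu> \<nu>"
    by (simp only: y0[OF \<mu> \<nu>])
  then show ?thesis using sums_zero by (rule sums_unique2)
qed

section \<open>Counting\<close>

lemma fock_mono:
  assumes "M \<le> M'"
  shows "fock N M \<subseteq> fock N M'"
proof
  fix \<nu> assume \<nu>: "\<nu> \<in> fock N M"
  then have "(\<Sum>j<M. \<nu> j) = (\<Sum>j<M'. \<nu> j)"
    using assms by (intro sum.mono_neutral_left) (auto simp: fock_def)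
  then show "\<nu> \<in> fock N M'" using \<nu> assms by (auto simp: fock_def)
qed

lemma wt_extend:
  assumes "M \<le> M'" "\<nu> \<in> fock N M"
  shows "wt M' \<nu> = wt M \<nu>"
proof -
  have "(\<Prod>j<M. fact (\<nu> j) :: real) = (\<Prod>j<M'. fact (\<nu> j))"
    using assms by (intro prod.mono_neutral_left) (auto simp: fock_def)
  then show ?thesis by (simp add: wt_def)
qed

text \<open>Incrementing an ancillary mode leaves the support of the padded operator, so only the
  first \<open>M\<close> summands remain; their weights agree because 0! = 1.\<close>

lemma contraction_ext_vac:
  assumes M: "M \<le> M'"
    and 0: "\<And>\<mu> \<nu>. \<mu> \<in> fock n M \<Longrightarrow> \<nu> \<in> fock n M \<Longrightarrow> contraction M X \<mu> \<nu> = 0"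
  shows "contraction M' (ext_vac (Suc n) M X) \<mu> \<nu> = 0"
proof (cases "\<mu> \<in> fock n M \<and> \<nu> \<in> fock n M")
  case True
  have "contraction M' (ext_vac (Suc n) M X) \<mu> \<nu>
      = (\<Sum>k<M. wt M' (inc k \<mu>) * wt M' (inc k \<nu>) * ext_vac (Suc n) M X (inc k \<mu>) (inc k \<nu>))"
    unfolding contraction_def using M
    by (intro sum.mono_neutral_right) (auto simp: ext_vac_def inc_notin_fock)
  also have "\<dots> = contraction M X \<mu> \<nu>"
    unfolding contraction_def
  proof (intro sum.cong refl)
    fix k assume "k \<in> {..<M}"
    then have "inc k \<mu> \<in> fock (Suc n) M" "inc k \<nu> \<in> fock (Suc n) M"
      using True by (simp_all add: inc_in_fock_iff)
    then show "wt M' (inc k \<mu>) * wt M' (inc k \<nu>) * ext_vac (Suc n) M X (inc k \<mu>) (inc k \<nu>)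
        = wt M (inc k \<mu>) * wt M (inc k \<nu>) * X (inc k \<mu>) (inc k \<nu>)"
      by (simp add: ext_vac_def wt_extend[OF M])
  qed
  finally show ?thesis using 0 True by simp
next
  case False
  have "ext_vac (Suc n) M X (inc k \<mu>) (inc k \<nu>) = 0" for k
    using False by (cases "k < M") (auto simp: ext_vac_def inc_in_fock_iff inc_notin_fock)
  then show ?thesis by (simp add: contraction_def)
qed

text \<open>Removes the padding, which makes linearity in \<open>X\<close> visible.\<close>

lemma prob_eq:
  assumes "M \<le> M'"
  shows "prob N M M' X H \<nu> = (\<Sum>a\<in>fock N M. \<Sum>b\<in>fock N M. cnj (Uop N M' H a \<nu>) * X a b * Uop N M' H b \<nu>)"
proof -
  let ?t = "\<lambda>a b. cnj (Uop N M' H a \<nu>) * ext_vac N M X a b * Uop N M' H b \<nu>"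
  have "prob N M M' X H \<nu> = (\<Sum>a\<in>fock N M'. \<Sum>b\<in>fock N M'. ?t a b)"
    by (simp add: prob_def Let_def)
  also have "\<dots> = (\<Sum>a\<in>fock N M. \<Sum>b\<in>fock N M'. ?t a b)"
    using fock_mono[OF assms]
    by (intro sum.mono_neutral_right) (auto simp: finite_fock ext_vac_def)
  also have "\<dots> = (\<Sum>a\<in>fock N M. \<Sum>b\<in>fock N M. ?t a b)"
    using fock_mono[OF assms]
    by (intro sum.cong refl sum.mono_neutral_right) (auto simp: finite_fock ext_vac_def)
  also have "\<dots> = (\<Sum>a\<in>fock N M. \<Sum>b\<in>fock N M. cnj (Uop N M' H a \<nu>) * X a b * Uop N M' H b \<nu>)"
    by (simp add: ext_vac_def)
  finally show ?thesis .
qed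

text \<open>Outcome probabilities are the diagonal of the conjugated padded operator, which still
  has zero contraction. Outcomes in \<open>fock (Suc n) m\<close>, with the last mode empty,
  therefore control all others.\<close>

lemma prob_vanishes:
  assumes M: "M \<le> Suc m" and H: "hermitian_mat (Suc m) H"
    and 0: "\<And>\<mu> \<nu>. \<mu> \<in> fock n M \<Longrightarrow> \<nu> \<in> fock n M \<Longrightarrow> contraction M X \<mu> \<nu> = 0"
    and init: "\<And>\<nu>. \<nu> \<in> fock (Suc n) m \<Longrightarrow> prob (Suc n) M (Suc m) X H \<nu> = 0"
    and \<nu>: "\<nu> \<in> fock (Suc n) (Suc m)"
  shows "prob (Suc n) M (Suc m) X H \<nu> = 0"
proof -
  define Y where "Y = (\<lambda>\<mu> \<nu>. \<Sum>a\<in>fock (Suc n) (Suc m). \<Sum>b\<in>fock (Suc n) (Suc m).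
    cnj (Uop (Suc n) (Suc m) H a \<mu>) * ext_vac (Suc n) M X a b * Uop (Suc n) (Suc m) H b \<nu>)"
  have Y: "prob (Suc n) M (Suc m) X H \<xi> = Y \<xi> \<xi>" for \<xi>
    by (simp add: prob_def Let_def Y_def)
  have c: "contraction (Suc m) Y \<mu> \<mu> = 0" if "\<mu> \<in> fock n (Suc m)" for \<mu>
    unfolding Y_def using H contraction_ext_vac[OF M 0] that that by (rule contraction_conjugate)
  show ?thesis
    unfolding Y using c init[unfolded Y] \<nu> by (rule diagonal_zero)
qed

text \<open>The maximally mixed state is interior among density operators, so it can be moved
  slightly in any traceless Hermitian direction.\<close>

lemma density_op_perturbation:
  assumes herm: "\<And>\<mu> \<nu>. \<mu> \<in> fock N M \<Longrightarrow> \<nu> \<in> fock N M \<Longrightarrow> T \<mu> \<nu> = cnj (T \<nu> \<mu>)"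
    and tr: "(\<Sum>\<mu>\<in>fock N M. T \<mu> \<mu>) = 0" and ne: "fock N M \<noteq> {}"
  shows "\<exists>\<epsilon>>0. density_op N M (\<lambda>\<mu> \<nu>. mid \<mu> \<nu> / of_nat (card (fock N M)) + of_real \<epsilon> * T \<mu> \<nu>)"
proof -
  let ?F = "fock N M"
  define D where "D = card ?F"
  define S where "S = (\<Sum>\<mu>\<in>?F. \<Sum>\<nu>\<in>?F. norm (T \<mu> \<nu>))"
  \<comment> \<open>\<open>S\<close> bounds the quadratic form of \<open>T\<close> on unit vectors
    and 1 / \<open>D\<close> is the form of the mixed state, so \<epsilon> S \<le> 1 / D suffices.
    The summand 1 covers \<open>T\<close> = 0.\<close>
  define \<epsilon> where "\<epsilon> = 1 / (real D * (S + 1))"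
  have D: "D > 0" using ne by (simp add: D_def finite_fock card_gt_0_iff)
  have S: "S \<ge> 0" by (simp add: S_def sum_nonneg)
  have eps: "\<epsilon> > 0" using D S by (simp add: \<epsilon>_def)
  have "S / (S + 1) \<le> 1" using S by simp
  then have "S / (S + 1) / real D \<le> 1 / real D" using D by (intro divide_right_mono) auto
  then have eS: "\<epsilon> * S \<le> 1 / real D" by (simp add: \<epsilon>_def mult.commute)
  have "0 \<le> Re (\<Sum>\<mu>\<in>?F. \<Sum>\<nu>\<in>?F. cnj (x \<mu>) * (mid \<mu> \<nu> / of_nat D + of_real \<epsilon> * T \<mu> \<nu>) * x \<nu>)" for x
  proof -
    define Q where "Q = (\<Sum>\<mu>\<in>?F. (norm (x \<mu>))\<^sup>2)"
    define q where "q = (\<Sum>\<mu>\<in>?F. \<Sum>\<nu>\<in>?F. cnj (x \<mu>) * T \<mu> \<nu> * x \<nu>)"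
    have Q: "Q \<ge> 0" by (simp add: Q_def sum_nonneg)
    have xx: "norm (x \<mu>) * norm (x \<nu>) \<le> Q" if "\<mu> \<in> ?F" "\<nu> \<in> ?F" for \<mu> \<nu>
    proof -
      have "(norm (x \<mu>))\<^sup>2 \<le> Q" "(norm (x \<nu>))\<^sup>2 \<le> Q"
        unfolding Q_def using that finite_fock by (auto intro!: member_le_sum)
      moreover have "2 * norm (x \<mu>) * norm (x \<nu>) \<le> (norm (x \<mu>))\<^sup>2 + (norm (x \<nu>))\<^sup>2"
        by (rule sum_squares_bound)
      ultimately show ?thesis by linarith
    qed
    have "norm q \<le> (\<Sum>\<mu>\<in>?F. \<Sum>\<nu>\<in>?F. norm (T \<mu> \<nu>) * Q)"
      unfolding q_def
    proof (intro sum_norm_le)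
      fix \<mu> \<nu> assume "\<mu> \<in> ?F" "\<nu> \<in> ?F"
      then have "norm (T \<mu> \<nu>) * (norm (x \<mu>) * norm (x \<nu>)) \<le> norm (T \<mu> \<nu>) * Q"
        by (intro mult_left_mono xx) auto
      then show "norm (cnj (x \<mu>) * T \<mu> \<nu> * x \<nu>) \<le> norm (T \<mu> \<nu>) * Q"
        by (simp add: norm_mult mult_ac)
    qed
    then have "norm q \<le> S * Q" by (simp add: S_def sum_distrib_right)
    then have "- (S * Q) \<le> Re q" using abs_Re_le_cmod[of q] by linarith
    then have "\<epsilon> * - (S * Q) \<le> \<epsilon> * Re q" using eps by (intro mult_left_mono) auto
    moreover have "\<epsilon> * S * Q \<le> 1 / real D * Q" using eS Q by (rule mult_right_mono)
    ultimately have pos: "0 \<le> Q / real D + \<epsilon> * Re q" by (simp add: algebra_simps)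
    have "(\<Sum>\<mu>\<in>?F. \<Sum>\<nu>\<in>?F. cnj (x \<mu>) * (mid \<mu> \<nu> / of_nat D + of_real \<epsilon> * T \<mu> \<nu>) * x \<nu>)
        = (\<Sum>\<mu>\<in>?F. \<Sum>\<nu>\<in>?F. (if \<nu> = \<mu> then of_real ((norm (x \<mu>))\<^sup>2 / real D) else 0)
            + of_real \<epsilon> * (cnj (x \<mu>) * T \<mu> \<nu> * x \<nu>))"
      by (intro sum.cong refl)
        (auto simp: mid_def complex_norm_square algebra_simps simp del: of_real_power)
    also have "\<dots> = of_real (Q / real D) + of_real \<epsilon> * q"
      by (simp add: sum.distrib finite_fock Q_def q_def sum_divide_distrib sum_distrib_left)
    finally show ?thesis using pos by simp
  qed
  moreover have "(\<Sum>\<mu>\<in>?F. mid \<mu> \<mu> / of_nat D + of_real \<epsilon> * T \<mu> \<mu>) = 1"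
    using D tr by (simp add: mid_def sum.distrib D_def flip: sum_distrib_left)
  moreover have "mid \<mu> \<nu> / of_nat D + of_real \<epsilon> * T \<mu> \<nu> = cnj (mid \<nu> \<mu> / of_nat D + of_real \<epsilon> * T \<nu> \<mu>)"
    if "\<mu> \<in> ?F" "\<nu> \<in> ?F" for \<mu> \<nu>
    using herm[OF that] by (auto simp: mid_def)
  ultimately have "density_op N M (\<lambda>\<mu> \<nu>. mid \<mu> \<nu> / of_nat D + of_real \<epsilon> * T \<mu> \<nu>)"
    unfolding density_op_def by blast
  then show ?thesis using eps unfolding D_def by blast
qed

section \<open>Operators that no outcome detects\<close>

text \<open>The interferometer has \<open>Suc m\<close> modes; outcomes are only tested with the last mode empty.\<close>

definition undetected :: "nat \<Rightarrow> nat \<Rightarrow> nat \<Rightarrow> nat \<Rightarrow> (nat \<Rightarrow> nat \<Rightarrow> nat \<Rightarrow> complex)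
    \<Rightarrow> ((nat \<Rightarrow> nat) \<Rightarrow> (nat \<Rightarrow> nat) \<Rightarrow> complex) \<Rightarrow> bool" where
  "undetected n M m R Hs X \<longleftrightarrow>
     (\<forall>\<mu>\<in>fock n M. \<forall>\<nu>\<in>fock n M. contraction M X \<mu> \<nu> = 0) \<and>
     (\<forall>j<R. \<forall>\<nu>\<in>fock (Suc n) m. prob (Suc n) M (Suc m) X (Hs j) \<nu> = 0)"

lemma undetected_linear:
  assumes "M \<le> Suc m" "undetected n M m R Hs X" "undetected n M m R Hs Y"
  shows "undetected n M m R Hs (\<lambda>a b. c * X a b + d * Y a b)"
proof -
  have "contraction M (\<lambda>a b. c * X a b + d * Y a b) \<mu> \<nu> = c * contraction M X \<mu> \<nu> + d * contraction M Y \<mu> \<nu>" for \<mu> \<nu>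
    by (simp add: contraction_def sum.distrib sum_distrib_left algebra_simps)
  moreover have "prob (Suc n) M (Suc m) (\<lambda>a b. c * X a b + d * Y a b) H \<nu>
      = c * prob (Suc n) M (Suc m) X H \<nu> + d * prob (Suc n) M (Suc m) Y H \<nu>" for H \<nu>
    by (simp add: prob_eq[OF assms(1)] sum.distrib sum_distrib_left algebra_simps)
  ultimately show ?thesis using assms(2,3) by (simp add: undetected_def)
qed

text \<open>Contraction and probabilities commute with taking adjoints, which gives access to
  Hermitian combinations.\<close>

lemma undetected_adjoint:
  assumes "M \<le> Suc m" "undetected n M m R Hs X"
  shows "undetected n M m R Hs (\<lambda>a b. cnj (X b a))"
proof -
  have "contraction M (\<lambda>a b. cnj (X b a)) \<mu> \<nu> = cnj (contraction M X \<nu> \<mu>)" for \<mu> \<nu>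
    by (simp add: contraction_def cnj_wt mult_ac)
  moreover have "prob (Suc n) M (Suc m) (\<lambda>a b. cnj (X b a)) H \<nu> = cnj (prob (Suc n) M (Suc m) X H \<nu>)" for H \<nu>
    unfolding prob_eq[OF assms(1)] by (subst sum.swap) (simp add: mult_ac)
  ultimately show ?thesis using assms(2) by (simp add: undetected_def)
qed

lemma undetected_exists:
  assumes M: "M \<le> Suc m"
    and less: "(card (fock n M))\<^sup>2 + R * card (fock (Suc n) m) < (card (fock (Suc n) M))\<^sup>2"
  shows "\<exists>X. undetected n M m R Hs X \<and> (\<exists>a\<in>fock (Suc n) M. \<exists>b\<in>fock (Suc n) M. X a b \<noteq> 0)"
proof -
  let ?F = "fock (Suc n) M"
  let ?E1 = "fock n M \<times> fock n M" and ?E2 = "{..<R} \<times> fock (Suc n) m"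
  \<comment> \<open>One unknown per matrix entry, indexed by a pair; \<open>Inl\<close> rows are the
    contraction equations and \<open>Inr\<close> rows the outcome equations.\<close>
  define A where "A e p = (case e of
      Inl (\<mu>, \<nu>) \<Rightarrow> (\<Sum>k<M. if p = (inc k \<mu>, inc k \<nu>) then wt M (inc k \<mu>) * wt M (inc k \<nu>) else 0)
    | Inr (j, \<nu>) \<Rightarrow> cnj (Uop (Suc n) (Suc m) (Hs j) (fst p) \<nu>) * Uop (Suc n) (Suc m) (Hs j) (snd p) \<nu>)" for e p
  have "card (?E1 <+> ?E2) < card (?F \<times> ?F)"
    using less by (simp add: card_Plus finite_fock card_cartesian_product power2_eq_square)
  from underdetermined_system[OF _ _ this, of A] obtain x where
    x: "\<exists>p\<in>?F \<times> ?F. x p \<noteq> 0" and sol: "\<And>e. e \<in> ?E1 <+> ?E2 \<Longrightarrow> (\<Sum>p\<in>?F \<times> ?F. A e p * x p) = 0"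
    by (auto simp: finite_fock)
  define X where "X a b = x (a, b)" for a b
  have "contraction M X \<mu> \<nu> = 0" if "\<mu> \<in> fock n M" "\<nu> \<in> fock n M" for \<mu> \<nu>
  proof -
    have "Inl (\<mu>, \<nu>) \<in> ?E1 <+> ?E2" using that by auto
    from sol[OF this] have "0 = (\<Sum>p\<in>?F \<times> ?F. A (Inl (\<mu>, \<nu>)) p * x p)" by (rule sym)
    also have "\<dots> = (\<Sum>p\<in>?F \<times> ?F. \<Sum>k<M. if p = (inc k \<mu>, inc k \<nu>) then wt M (inc k \<mu>) * wt M (inc k \<nu>) * x p else 0)"
      by (auto simp: A_def sum_distrib_right intro!: sum.cong)
    also have "\<dots> = (\<Sum>k<M. \<Sum>p\<in>?F \<times> ?F. if p = (inc k \<mu>, inc k \<nu>) then wt M (inc k \<mu>) * wt M (inc k \<nu>) * x p else 0)"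
      by (rule sum.swap)
    also have "\<dots> = contraction M X \<mu> \<nu>"
      unfolding contraction_def
      by (intro sum.cong refl) (use that in \<open>simp add: finite_fock inc_in_fock_iff X_def\<close>)
    finally show ?thesis by simp
  qed
  moreover have "prob (Suc n) M (Suc m) X (Hs j) \<nu> = 0" if "j < R" "\<nu> \<in> fock (Suc n) m" for j \<nu>
  proof -
    have "Inr (j, \<nu>) \<in> ?E1 <+> ?E2" using that by auto
    from sol[OF this] show ?thesis
      unfolding prob_eq[OF M] by (simp add: A_def X_def sum.cartesian_product case_prod_unfold mult_ac)
  qed
  moreover have "\<exists>a\<in>?F. \<exists>b\<in>?F. X a b \<noteq> 0" using x by (auto simp: X_def)
  ultimately show ?thesis unfolding undetected_def by blast
qed

lemma undetected_hermitian_exists: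
  assumes M: "M \<le> Suc m"
    and less: "(card (fock n M))\<^sup>2 + R * card (fock (Suc n) m) < (card (fock (Suc n) M))\<^sup>2"
  shows "\<exists>T. undetected n M m R Hs T \<and> (\<exists>a\<in>fock (Suc n) M. \<exists>b\<in>fock (Suc n) M. T a b \<noteq> 0)
           \<and> (\<forall>a b. T a b = cnj (T b a))"
proof -
  obtain X a b where X: "undetected n M m R Hs X"
    and ab: "a \<in> fock (Suc n) M" "b \<in> fock (Suc n) M" "X a b \<noteq> 0"
    using undetected_exists[OF assms, of Hs] by blast
  \<comment> \<open>Twice the Hermitian part and, up to sign, twice the anti-Hermitian part divided
    by \<open>\<i>\<close>. As 2 X = T1 - \<open>\<i>\<close> T2, they cannot both vanish at
    \<open>a\<close>, \<open>b\<close>. The explicit coefficients match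
    \<open>undetected_linear\<close>.\<close>
  define T1 where "T1 a b = 1 * X a b + 1 * cnj (X b a)" for a b
  define T2 where "T2 a b = \<i> * X a b + (-\<i>) * cnj (X b a)" for a b
  have "undetected n M m R Hs T1" "undetected n M m R Hs T2"
    unfolding T1_def[abs_def] T2_def[abs_def]
    by (rule undetected_linear[OF M X undetected_adjoint[OF M X]])+
  moreover have "T1 a b = cnj (T1 b a)" "T2 a b = cnj (T2 b a)" for a b
    by (simp_all add: T1_def T2_def algebra_simps)
  moreover have "T1 a b \<noteq> 0 \<or> T2 a b \<noteq> 0"
  proof (rule ccontr)
    assume "\<not> (T1 a b \<noteq> 0 \<or> T2 a b \<noteq> 0)"
    moreover have "2 * X a b = T1 a b - \<i> * T2 a b"
      by (simp add: T1_def T2_def algebra_simps)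
    ultimately show False using ab by simp
  qed
  ultimately show ?thesis using ab by blast
qed

lemma reconstruction_count:
  assumes M: "M \<le> Suc m" and H: "\<And>j. j < R \<Longrightarrow> hermitian_mat (Suc m) (Hs j)"
    and rec: "reconstructs (Suc n) M (Suc m) R Hs"
  shows "(card (fock (Suc n) M))\<^sup>2 \<le> (card (fock n M))\<^sup>2 + R * card (fock (Suc n) m)"
proof (rule ccontr)
  let ?F = "fock (Suc n) M"
  assume "\<not> ?thesis"
  then obtain T a b where T: "undetected n M m R Hs T" and herm: "\<And>a b. T a b = cnj (T b a)"
    and ab: "a \<in> ?F" "b \<in> ?F" "T a b \<noteq> 0"
    using undetected_hermitian_exists[OF M, of n R Hs] by (metis not_le)
  have c: "contraction M T \<mu> \<nu> = 0" if "\<mu> \<in> fock n M" "\<nu> \<in> fock n M" for \<mu> \<nu>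
    using T that by (simp add: undetected_def)
  have tr: "(\<Sum>\<mu>\<in>?F. T \<mu> \<mu>) = 0" by (rule trace_zero) (rule c)
  have ne: "?F \<noteq> {}" using ab by auto
  let ?mix = "\<lambda>\<mu> \<nu>. mid \<mu> \<nu> / of_nat (card ?F) :: complex"
  obtain \<epsilon> where eps: "\<epsilon> > 0" and d1: "density_op (Suc n) M (\<lambda>\<mu> \<nu>. ?mix \<mu> \<nu> + of_real \<epsilon> * T \<mu> \<nu>)"
    using density_op_perturbation[where T = T, OF herm tr ne] by blast
  \<comment> \<open>The zero perturbation shows that the maximally mixed state is itself a density
    operator.\<close>
  have d2: "density_op (Suc n) M ?mix"
    using density_op_perturbation[of "Suc n" M "\<lambda>_ _. 0"] ne by simp
  have "prob (Suc n) M (Suc m) (\<lambda>\<mu> \<nu>. ?mix \<mu> \<nu> + of_real \<epsilon> * T \<mu> \<nu>) (Hs j) \<nu>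
      = prob (Suc n) M (Suc m) ?mix (Hs j) \<nu>" if "j < R" "\<nu> \<in> fock (Suc n) (Suc m)" for j \<nu>
  proof -
    have "prob (Suc n) M (Suc m) T (Hs j) \<nu> = 0"
      using M H[OF that(1)] c _ that(2)
      by (rule prob_vanishes) (use T that(1) in \<open>simp_all add: undetected_def\<close>)
    moreover have "prob (Suc n) M (Suc m) (\<lambda>\<mu> \<nu>. ?mix \<mu> \<nu> + of_real \<epsilon> * T \<mu> \<nu>) (Hs j) \<nu>
      = prob (Suc n) M (Suc m) ?mix (Hs j) \<nu> + of_real \<epsilon> * prob (Suc n) M (Suc m) T (Hs j) \<nu>"
      by (simp add: prob_eq[OF M] sum.distrib sum_distrib_left algebra_simps)
    ultimately show ?thesis by simp
  qed
  then have "\<forall>\<mu>\<in>?F. \<forall>\<nu>\<in>?F. ?mix \<mu> \<nu> + of_real \<epsilon> * T \<mu> \<nu> = ?mix \<mu> \<nu>"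
    using rec[unfolded reconstructs_def, rule_format, OF d1 d2] by blast
  then show False using ab eps by auto
qed

section \<open>From dimensions to binomial coefficients\<close>

lemma R_NM_eq: "R_NM (Suc n) (Suc (Suc m)) = real (card (fock (Suc n) (Suc (Suc m))) + card (fock n (Suc (Suc m))))"
proof -
  \<comment> \<open>Pascal's rule is applied once here and once more to the first summand; this
    produces the binomial that \<open>R_NM\<close> subtracts.\<close>
  have "(Suc n + Suc (Suc m)) choose Suc n = (Suc (n + Suc m) choose n) + (Suc (n + Suc m) choose Suc n)"
    by simp
  moreover have "Suc (n + Suc m) choose n = Suc (n + Suc m) choose Suc (Suc m)"
    by (subst binomial_symmetric) auto
  moreover have "\<dots> = ((n + Suc m) choose Suc m) + ((n + Suc m) choose Suc (Suc m))"
    by simp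
  moreover have "(n + Suc m) choose Suc m = (n + Suc m) choose n"
    by (subst binomial_symmetric) auto
  ultimately show ?thesis
    by (simp add: R_NM_def card_fock)
qed

text \<open>The difference of squares factors as (d - d1)(d + d1): the first factor is the dimension
  with one mode fewer, the second is \<open>R_NM\<close>. Allowing m = m' covers the case without
  ancillas.\<close>

lemma reconstruction_bound:
  assumes m: "m \<le> m'" and H: "\<And>j. j < R \<Longrightarrow> hermitian_mat (Suc (Suc m')) (Hs j)"
    and rec: "reconstructs (Suc n) (Suc (Suc m)) (Suc (Suc m')) R Hs"
  shows "real (card (fock (Suc n) (Suc m))) * R_NM (Suc n) (Suc (Suc m)) \<le> real R * real (card (fock (Suc n) (Suc m')))"
proof -
  let ?d = "card (fock (Suc n) (Suc (Suc m)))" and ?d1 = "card (fock n (Suc (Suc m)))" and ?q = "card (fock (Suc n) (Suc m))"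
  have "?d\<^sup>2 \<le> ?d1\<^sup>2 + R * card (fock (Suc n) (Suc m'))"
    using m by (intro reconstruction_count[OF _ H rec]) auto
  moreover have "?d = ?q + ?d1" by (rule card_fock_Suc_Suc)
  then have "?d\<^sup>2 = ?d1\<^sup>2 + ?q * (?d + ?d1)" by (simp add: power2_eq_square algebra_simps)
  ultimately have "?q * (?d + ?d1) \<le> R * card (fock (Suc n) (Suc m'))" by linarith
  then show ?thesis unfolding R_NM_eq by (metis of_nat_le_iff of_nat_mult)
qed

theorem theorem2:
  fixes N M :: nat
  assumes "N \<ge> 1" and "M \<ge> 2"
  shows "(\<forall>R Hs. (\<forall>j<R. hermitian_mat M (Hs j)) \<longrightarrow> reconstructs N M M R Hs
            \<longrightarrow> real R \<ge> R_NM N M)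
       \<and> (\<forall>M' R Hs. M' > M \<longrightarrow> (\<forall>j<R. hermitian_mat M' (Hs j)) \<longrightarrow> reconstructs N M M' R Hs
            \<longrightarrow> int R \<ge> R_NMM' N M M')"
proof -
  obtain n m where N: "N = Suc n" and M: "M = Suc (Suc m)"
    using assms by (metis Suc_le_D One_nat_def numeral_2_eq_2 Suc_le_mono)
  have card_pos: "card (fock N (Suc k)) > 0" for k
    by (simp add: card_fock)
  show ?thesis
  proof (intro conjI allI impI)
    fix R Hs assume "\<forall>j<R. hermitian_mat M (Hs j)" "reconstructs N M M R Hs"
    \<comment> \<open>Without ancillas both sides carry the same positive dimension, which
      cancels.\<close>
    then have "real (card (fock N (Suc m))) * R_NM N M \<le> real R * real (card (fock N (Suc m)))"
      unfolding N M by (intro reconstruction_bound) auto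
    then show "real R \<ge> R_NM N M"
      using card_pos[of m] by (simp add: mult.commute)
  next
    fix M' R Hs assume "M < M'" and H: "\<forall>j<R. hermitian_mat M' (Hs j)" and rec: "reconstructs N M M' R Hs"
    define m' where "m' = M' - 2"
    have M': "M' = Suc (Suc m')" and "m \<le> m'" using \<open>M < M'\<close> M by (auto simp: m'_def)
    let ?q = "real (card (fock N (Suc m)))" and ?q' = "real (card (fock N (Suc m')))"
    have bound: "?q * R_NM N M \<le> real R * ?q'"
      using H rec \<open>m \<le> m'\<close> unfolding N M M' by (intro reconstruction_bound) auto
    have q: "real (card (fock N (Suc k))) = fact (N + k) / (fact N * fact k)" for k
      by (simp add: card_fock binomial_fact)
    \<comment> \<open>In the quotient of the two dimensions \<open>fact N\<close> cancels, leaving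
      the stated ratio of factorials.\<close>
    have "real (fact (N + M - 2) * fact (M' - 2)) / real (fact (N + M' - 2) * fact (M - 2)) = ?q / ?q'"
      unfolding q by (simp add: M M' field_simps)
    moreover have "?q / ?q' * R_NM N M \<le> real R"
      using bound card_pos[of m'] by (simp add: field_simps)
    ultimately show "int R \<ge> R_NMM' N M M'"
      unfolding R_NMM'_def ceiling_le_iff by simp
  qed
qed

end
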